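(* Let Model 19 (Kreweras walks) be the step set $\{(-1,0),(0,-1),(1,1)\}$ and Model 20 (reverse Kreweras walks) the step set $\{(1,0),(0,1),(-1,-1)\}$. For each of these let $G(t;a,b)$ be the length generating function of quarter plane walks starting and ending at the origin, with weight $a$ per visit to the line $y=0$ and weight $b$ per visit to the line $x=0$. Then, for each of Models 19 and 20, the generating function $G(t;a,a)$ is algebraic.
   Context: Given a step set $\mathcal{S}\subseteq\{-1,0,1\}^2\setminus\{(0,0)\}$, a quarter plane walk of length $n$ is a walk in $\mathbb{Z}_{\ge 0}^2$ starting at $(0,0)$ and taking $n$ steps from $\mathcal{S}$, all of whose vertices lie in $\mathbb{Z}_{\ge0}^2$. Let $q_{n,k,\ell,h,v}$ be the number of such walks of length $n$ ending at $(k,\ell)$ which visit the horizontal boundary $y=0$ exactly $h$ times and the vertical boundary $x=0$ exactly $v$ times. The origin belongs to both boundaries, so a visit to the origin contributes $1$ to both $h$ and $v$ (weight $ab$). The starting vertex is not counted as a visit, so the empty walk has weight $1$. Define $$G(t;a,b)=\sum_{n\ge0}t^n\sum_{h,v\ge0}q_{n,0,0,h,v}\,a^hb^v\in\mathbb{Z}[a,b][[t]].$$ Algebraic means that $G(t;a,a)$, as a power series in $t$ with $a$ regarded as an indeterminate, is algebraic over the field $\mathbb{Q}(a,t)$. *)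

theory Defs
  imports
    "HOL-Library.Product_Plus"
    "HOL-Computational_Algebra.Computational_Algebra"
begin

(* A walk is the list of its n + 1 vertices, starting vertex included. *)
definition quarter_plane_walks :: "(int \<times> int) set \<Rightarrow> nat \<Rightarrow> (int \<times> int) list set" where
  "quarter_plane_walks S n =
     {w. length w = Suc n \<and> w ! 0 = (0, 0) \<and>
         (\<forall>i<n. w ! Suc i - w ! i \<in> S) \<and>
         (\<forall>i\<le>n. 0 \<le> fst (w ! i) \<and> 0 \<le> snd (w ! i))}"

(* The index ranges start at 1 because the starting vertex is not a visit. *)
definition horizontal_visits :: "(int \<times> int) list \<Rightarrow> nat" where
  "horizontal_visits w = card {i. 1 \<le> i \<and> i < length w \<and> snd (w ! i) = 0}"

definition vertical_visits :: "(int \<times> int) list \<Rightarrow> nat" where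
  "vertical_visits w = card {i. 1 \<le> i \<and> i < length w \<and> fst (w ! i) = 0}"

definition walk_count :: "(int \<times> int) set \<Rightarrow> nat \<Rightarrow> nat \<Rightarrow> nat \<Rightarrow> nat \<Rightarrow> nat \<Rightarrow> nat" where
  "walk_count S n k l h v =
     card {w \<in> quarter_plane_walks S n. w ! n = (int k, int l) \<and>
             horizontal_visits w = h \<and> vertical_visits w = v}"

(* G(t;a,b), with the weights a and b taken in an arbitrary commutative ring.
   A walk of length n has at most n visits to either boundary, so the sums
   over h and v up to n are the full sums over all h and v. *)
definition excursion_gf :: "(int \<times> int) set \<Rightarrow> 'a \<Rightarrow> 'a \<Rightarrow> 'a :: comm_ring_1 fps" where
  "excursion_gf S a b =
     Abs_fps (\<lambda>n. \<Sum>h\<le>n. \<Sum>v\<le>n. of_nat (walk_count S n 0 0 h v) * a ^ h * b ^ v)"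

definition kreweras_steps :: "(int \<times> int) set" where
  "kreweras_steps = {(-1, 0), (0, -1), (1, 1)}"

definition reverse_kreweras_steps :: "(int \<times> int) set" where
  "reverse_kreweras_steps = {(1, 0), (0, 1), (-1, -1)}"

(* The common ambient field is Q(a)((t)), the type rat poly fract fls: the
   variable of rat poly is a, and t is the variable of the Laurent series. *)

definition indet_a :: "rat poly fract" where
  "indet_a = to_fract [:0, 1:]"

(* The inclusion of Q[a][t] = Q[a,t] into Q(a)((t)). *)
definition bipoly_to_fls :: "rat poly poly \<Rightarrow> rat poly fract fls" where
  "bipoly_to_fls p = fps_to_fls (fps_of_poly (map_poly to_fract p))"

(* The subfield Q(a,t) of Q(a)((t)). *)
definition rational_functions :: "rat poly fract fls set" where
  "rational_functions = {bipoly_to_fls p / bipoly_to_fls q | p q. q \<noteq> 0}"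

definition algebraic_over :: "'a :: field set \<Rightarrow> 'a \<Rightarrow> bool" where
  "algebraic_over K x \<longleftrightarrow> (\<exists>p. (\<forall>i. coeff p i \<in> K) \<and> p \<noteq> 0 \<and> poly p x = 0)"

end

theory Submission
  imports Defs
begin

text \<open>
  Reading a closed walk backwards turns Kreweras steps into reverse Kreweras steps and keeps the
  number of boundary visits, so both models have the same excursion series
  (\<open>excursion_gf_reverse\<close>) and only the reverse Kreweras steps are studied.

  Let \<open>Q(x,y)\<close> be the series of all weighted walks with their endpoint marked, \<open>R(x) = Q(x,0)\<close>
  (by symmetry also \<open>Q(0,x)\<close>) and \<open>G = R(0)\<close>. Removing the last step of a walk gives
  \<open>M Q = (\<alpha> x y - t) (R(x) + R(y) - G) + \<kappa> x y\<close> with the kernel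
  \<open>M = x y - t x\<^sup>2 y - t x y\<^sup>2 - t\<close>, \<open>\<alpha> = 1 - 1/a\<close> and \<open>\<kappa> = (1-\<alpha>)\<^sup>2 + \<alpha> (1-\<alpha>) G\<close>
  (\<open>walk_series_equation\<close>). The proof is an instance of Tutte's method of invariants: two series
  \<open>p(x)\<close> and \<open>q(y)\<close> whose difference is \<open>M N\<close>, with \<open>N\<close> a power series in \<open>x\<close>, \<open>y\<close> and \<open>t\<close>, are
  equal constants, because comparing mixed coefficients forces \<open>N = 0\<close>
  (\<open>kernel_multiple_separated\<close>). This is used twice.

  Without weights, so that \<open>\<alpha> = 0\<close> and \<open>\<kappa> = 1\<close>, the function \<open>i(x) = t\<^sup>2 R(x) - x + t x\<^sup>2\<close> agrees modulo
  \<open>M\<close> with a function of \<open>y\<close> alone. So does \<open>1/x + x/t - x\<^sup>2\<close>. Eliminating their poles produces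
  a quadratic equation for \<open>i\<close> whose coefficients involve two unknown series in \<open>t\<close>
  (\<open>invariant_quadratic\<close>). Its discriminant has to vanish at the two small solutions of \<open>X\<^sup>2 = t + 2 t X\<^sup>3\<close>, and this determines
  both unknowns (\<open>unweighted_coefficients\<close>). These solutions are series in \<open>s = \<surd>t\<close>, so everything
  is computed with series in \<open>s\<close> and with \<open>t\<close> replaced by a series \<open>T\<close>, finally \<open>T = s\<^sup>2\<close>.

  With weights there is a similar function of \<open>x\<close> that agrees with a function of \<open>y\<close>. It has one pole,
  at the small root \<open>X\<close> of \<open>\<alpha> t x\<^sup>2 + \<alpha> (\<alpha>-1) x + t\<^sup>2\<close>. After a constant is subtracted from it, its
  product with \<open>i(x) - i(X)\<close> has no pole in \<open>x\<close> or \<open>y\<close>, so it is constant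
  (\<open>weighted_boundary_equation\<close>). Comparing \<open>x = 0\<close> with \<open>x = X\<close> gives a linear equation for \<open>G\<close>
  (\<open>weighted_excursion_equation\<close>) whose coefficients are built from \<open>X\<close>, \<open>i(X)\<close>, \<open>i'(X)\<close> and the
  unweighted excursion series. All of these are algebraic, hence so is \<open>G(s\<^sup>2)\<close>
  (\<open>weighted_excursions_algebraic\<close>). As \<open>f(t) \<mapsto> f(s\<^sup>2)\<close> is an embedding of fields, so is \<open>G(t)\<close>.
\<close>

section \<open>Weighted walks and their reversal\<close>

definition walks_to :: "(int \<times> int) set \<Rightarrow> nat \<Rightarrow> int \<times> int \<Rightarrow> (int \<times> int) list set" where
  "walks_to S n p = {w \<in> quarter_plane_walks S n. w ! n = p}"

definition in_quadrant :: "int \<times> int \<Rightarrow> bool" where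
  "in_quadrant p \<longleftrightarrow> 0 \<le> fst p \<and> 0 \<le> snd p"

lemma walks_to_0: "walks_to S 0 p = (if p = (0, 0) then {[(0, 0)]} else {})"
proof -
  have "w = [(0, 0)]" if "length w = Suc 0" "w ! 0 = (0, 0)" for w :: "(int \<times> int) list"
    using that by (cases w) auto
  then show ?thesis by (auto simp: walks_to_def quarter_plane_walks_def)
qed

lemma walks_to_Suc:
  "walks_to S (Suc n) p = (if in_quadrant p then \<Union>d\<in>S. (\<lambda>w. w @ [p]) ` walks_to S n (p - d) else {})"
proof (intro set_eqI iffI)
  fix w assume w: "w \<in> walks_to S (Suc n) p"
  define u where "u = take (Suc n) w"
  have len: "length w = Suc (Suc n)" and last: "w ! Suc n = p"
    using w by (auto simp: walks_to_def quarter_plane_walks_def)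
  have nth: "u ! i = w ! i" if "i \<le> n" for i using that by (simp add: u_def)
  have wu: "w = u @ [p]"
    using len last take_Suc_conv_app_nth[of "Suc n" w] by (simp add: u_def)
  have "in_quadrant p" using w unfolding walks_to_def quarter_plane_walks_def in_quadrant_def by auto
  moreover have "p - w ! n \<in> S" using w last by (auto simp: walks_to_def quarter_plane_walks_def)
  moreover have "u \<in> walks_to S n (p - (p - w ! n))"
    using w len nth by (auto simp: walks_to_def quarter_plane_walks_def u_def)
  ultimately show "w \<in> (if in_quadrant p then \<Union>d\<in>S. (\<lambda>w. w @ [p]) ` walks_to S n (p - d) else {})"
    by (subst wu) (auto intro!: bexI[of _ "p - w ! n"])
next
  fix w assume "w \<in> (if in_quadrant p then \<Union>d\<in>S. (\<lambda>w. w @ [p]) ` walks_to S n (p - d) else {})"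
  then obtain d u where *: "in_quadrant p" "d \<in> S" "u \<in> walks_to S n (p - d)" "w = u @ [p]"
    by (auto split: if_splits)
  then show "w \<in> walks_to S (Suc n) p"
    by (auto simp: walks_to_def quarter_plane_walks_def nth_append in_quadrant_def less_Suc_eq le_Suc_eq)
qed

lemma finite_walks_to: "finite S \<Longrightarrow> finite (walks_to S n p)"
  by (induction n arbitrary: p) (auto simp: walks_to_0 walks_to_Suc)

definition visits :: "(int \<times> int) list \<Rightarrow> nat" where
  "visits w = horizontal_visits w + vertical_visits w"

lemma horizontal_visits_snoc:
  "w \<noteq> [] \<Longrightarrow> horizontal_visits (w @ [p]) = horizontal_visits w + (if snd p = 0 then 1 else 0)"
proof -
  assume "w \<noteq> []"
  then have "{i. 1 \<le> i \<and> i < length (w @ [p]) \<and> snd ((w @ [p]) ! i) = 0} =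
     {i. 1 \<le> i \<and> i < length w \<and> snd (w ! i) = 0} \<union> (if snd p = 0 then {length w} else {})"
    by (auto simp: nth_append less_Suc_eq Suc_le_eq split: if_splits)
  then show ?thesis unfolding horizontal_visits_def by simp
qed

lemma vertical_visits_snoc:
  "w \<noteq> [] \<Longrightarrow> vertical_visits (w @ [p]) = vertical_visits w + (if fst p = 0 then 1 else 0)"
proof -
  assume "w \<noteq> []"
  then have "{i. 1 \<le> i \<and> i < length (w @ [p]) \<and> fst ((w @ [p]) ! i) = 0} =
     {i. 1 \<le> i \<and> i < length w \<and> fst (w ! i) = 0} \<union> (if fst p = 0 then {length w} else {})"
    by (auto simp: nth_append less_Suc_eq Suc_le_eq split: if_splits)
  then show ?thesis unfolding vertical_visits_def by simp
qed

definition weight :: "(int \<times> int) set \<Rightarrow> 'a::comm_ring_1 \<Rightarrow> nat \<Rightarrow> int \<times> int \<Rightarrow> 'a" where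
  "weight S a n p = (\<Sum>w\<in>walks_to S n p. a ^ visits w)"

definition arrival_weight :: "'a::comm_ring_1 \<Rightarrow> int \<times> int \<Rightarrow> 'a" where
  "arrival_weight a p = (if snd p = 0 then a else 1) * (if fst p = 0 then a else 1)"

lemma weight_0: "weight S a 0 p = (if p = (0, 0) then 1 else 0)"
proof -
  have "visits [(0, 0)] = 0"
    unfolding visits_def horizontal_visits_def vertical_visits_def by (auto simp: card_eq_0_iff)
  then show ?thesis by (simp add: weight_def walks_to_0)
qed

lemma weight_Suc:
  assumes "finite S"
  shows "weight S a (Suc n) p =
    (if in_quadrant p then arrival_weight a p * (\<Sum>d\<in>S. weight S a n (p - d)) else 0)"
proof (cases "in_quadrant p")
  case True
  have disj: "(\<lambda>w. w @ [p]) ` walks_to S n (p - d) \<inter> (\<lambda>w. w @ [p]) ` walks_to S n (p - d') = {}" if "d \<noteq> d'" for d d'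
    using that by (auto simp: walks_to_def)
  have "weight S a (Suc n) p = (\<Sum>d\<in>S. \<Sum>w\<in>(\<lambda>w. w @ [p]) ` walks_to S n (p - d). a ^ visits w)"
    unfolding weight_def walks_to_Suc if_P[OF True]
    by (rule sum.UNION_disjoint) (use assms disj in \<open>simp_all add: finite_walks_to\<close>)
  also have "\<dots> = (\<Sum>d\<in>S. \<Sum>w\<in>walks_to S n (p - d). a ^ visits (w @ [p]))"
    by (simp add: sum.reindex inj_on_def)
  also have "\<dots> = (\<Sum>d\<in>S. \<Sum>w\<in>walks_to S n (p - d). arrival_weight a p * a ^ visits w)"
  proof (intro sum.cong refl)
    fix d w assume "w \<in> walks_to S n (p - d)"
    then have "w \<noteq> []" by (auto simp: walks_to_def quarter_plane_walks_def)
    then show "a ^ visits (w @ [p]) = arrival_weight a p * a ^ visits w"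
      by (simp add: visits_def horizontal_visits_snoc vertical_visits_snoc arrival_weight_def power_add)
  qed
  finally show ?thesis using True by (simp add: weight_def sum_distrib_left)
qed (simp add: weight_def walks_to_Suc)

lemma weight_outside: "\<not> in_quadrant p \<Longrightarrow> weight S a n p = 0"
  by (cases n) (auto simp: weight_def walks_to_Suc walks_to_0 in_quadrant_def)

lemma visits_le:
  assumes "w \<in> walks_to S n p"
  shows "horizontal_visits w \<le> n" "vertical_visits w \<le> n"
proof -
  have "length w = Suc n" using assms by (simp add: walks_to_def quarter_plane_walks_def)
  then have sub: "{i. 1 \<le> i \<and> i < length w \<and> snd (w ! i) = 0} \<subseteq> {1..n}"
    "{i. 1 \<le> i \<and> i < length w \<and> fst (w ! i) = 0} \<subseteq> {1..n}"
    by auto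
  from sub[THEN card_mono[OF finite_atLeastAtMost]] show "horizontal_visits w \<le> n" "vertical_visits w \<le> n"
    by (simp_all add: horizontal_visits_def vertical_visits_def)
qed

text \<open>Every walk lies in exactly one class of fixed numbers of visits, and with equal weights only the
total number of visits matters.\<close>

lemma excursion_gf_eq_weight:
  assumes "finite S"
  shows "excursion_gf S a a = Abs_fps (\<lambda>n. weight S a n (0, 0))"
proof (rule fps_ext)
  fix n
  let ?W = "walks_to S n (0, 0)"
  have fin: "finite ?W" by (rule finite_walks_to[OF assms])
  have "excursion_gf S a a $ n =
     (\<Sum>h\<le>n. \<Sum>v\<le>n. \<Sum>w\<in>?W. if horizontal_visits w = h \<and> vertical_visits w = v then a ^ h * a ^ v else 0)"
    unfolding excursion_gf_def walk_count_def fps_nth_Abs_fps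
  proof (intro sum.cong refl)
    fix h v
    have "{w \<in> quarter_plane_walks S n. w ! n = (int 0, int 0) \<and> horizontal_visits w = h \<and> vertical_visits w = v} =
      {w \<in> ?W. horizontal_visits w = h \<and> vertical_visits w = v}" by (auto simp: walks_to_def)
    then show "of_nat (card {w \<in> quarter_plane_walks S n. w ! n = (int 0, int 0) \<and> horizontal_visits w = h \<and> vertical_visits w = v})
       * a ^ h * a ^ v = (\<Sum>w\<in>?W. if horizontal_visits w = h \<and> vertical_visits w = v then a ^ h * a ^ v else 0)"
      using fin by (simp add: sum.If_cases Int_def mult.assoc)
  qed
  also have "\<dots> = (\<Sum>w\<in>?W. \<Sum>h\<le>n. \<Sum>v\<le>n. if horizontal_visits w = h \<and> vertical_visits w = v then a ^ h * a ^ v else 0)"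
    by (simp only: sum.swap[of _ ?W])
  also have "\<dots> = (\<Sum>w\<in>?W. a ^ visits w)"
  proof (intro sum.cong refl)
    fix w assume "w \<in> ?W"
    then have le: "horizontal_visits w \<le> n" "vertical_visits w \<le> n" by (rule visits_le)+
    have "(\<Sum>h\<le>n. \<Sum>v\<le>n. if horizontal_visits w = h \<and> vertical_visits w = v then a ^ h * a ^ v else 0) =
       (\<Sum>h\<le>n. if horizontal_visits w = h then \<Sum>v\<le>n. if vertical_visits w = v then a ^ h * a ^ v else 0 else 0)"
      by (intro sum.cong refl) auto
    then show "(\<Sum>h\<le>n. \<Sum>v\<le>n. if horizontal_visits w = h \<and> vertical_visits w = v then a ^ h * a ^ v else 0) = a ^ visits w"
      using le by (simp add: visits_def power_add)
  qed
  finally show "excursion_gf S a a $ n = Abs_fps (\<lambda>n. weight S a n (0, 0)) $ n"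
    by (simp add: weight_def)
qed

text \<open>Visits are counted at the times \<open>1, \<dots>, n\<close>. A closed walk starts and ends on both boundaries,
so this is one less than the count over the times \<open>0, \<dots>, n\<close>, and that count is visibly
invariant under reversal.\<close>

lemma rev_excursion:
  assumes "w \<in> walks_to S n (0, 0)"
  shows "rev w \<in> walks_to (uminus ` S) n (0, 0)"
    and "visits (rev w) = visits w"
proof -
  have w: "length w = Suc n" "w ! 0 = (0, 0)" "w ! n = (0, 0)" "\<And>i. i < n \<Longrightarrow> w ! Suc i - w ! i \<in> S"
    "\<And>i. i \<le> n \<Longrightarrow> 0 \<le> fst (w ! i) \<and> 0 \<le> snd (w ! i)"
    using assms by (auto simp: walks_to_def quarter_plane_walks_def)
  have rev: "rev w ! i = w ! (n - i)" if "i \<le> n" for i using that w by (simp add: rev_nth)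
  have "rev w ! Suc i - rev w ! i \<in> uminus ` S" if "i < n" for i
  proof -
    have "w ! Suc (n - Suc i) - w ! (n - Suc i) \<in> S" using that by (intro w) simp
    then have "- (w ! (n - i) - w ! (n - Suc i)) \<in> uminus ` S" using that
      by (simp only: Suc_diff_Suc imageI)
    then show ?thesis using that by (simp add: rev)
  qed
  then show "rev w \<in> walks_to (uminus ` S) n (0, 0)"
    using w rev by (simp add: walks_to_def quarter_plane_walks_def)
  have count: "card {i. 1 \<le> i \<and> i < length u \<and> f (u ! i) = (0::int)} = card {i. i \<le> n \<and> f (u ! i) = 0} - 1"
    if "length u = Suc n" "f (u ! 0) = 0" for u :: "(int \<times> int) list" and f
  proof -
    have "{i. 1 \<le> i \<and> i < length u \<and> f (u ! i) = 0} = {i. i \<le> n \<and> f (u ! i) = 0} - {0}"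
      using that by auto
    then show ?thesis using that by (simp add: card_Diff_subset)
  qed
  have "card {i. i \<le> n \<and> f (rev w ! i) = (0::int)} = card {i. i \<le> n \<and> f (w ! i) = 0}" for f
    by (rule bij_betw_same_card[of "\<lambda>i. n - i"], rule bij_betwI[where g = "\<lambda>i. n - i"]) (auto simp: rev)
  then have "card {i. 1 \<le> i \<and> i < length (rev w) \<and> f (rev w ! i) = (0::int)} = card {i. 1 \<le> i \<and> i < length w \<and> f (w ! i) = 0}"
    if "f (0, 0) = 0" for f
    using that w rev[of 0] count[of "rev w" f] count[of w f] by simp
  from this[of fst] this[of snd] show "visits (rev w) = visits w"
    by (simp add: visits_def horizontal_visits_def vertical_visits_def)
qed

lemma excursion_gf_reverse:
  assumes "finite S"
  shows "excursion_gf (uminus ` S) a a = excursion_gf S a a"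
proof -
  have inv: "uminus ` uminus ` S = S" by (auto simp: image_image)
  have "weight (uminus ` S) a n (0, 0) = weight S a n (0, 0)" for n
    unfolding weight_def
    by (rule sum.reindex_bij_witness[where i = rev and j = rev])
       (use rev_excursion[of _ S n] rev_excursion[of _ "uminus ` S" n, unfolded inv] in auto)
  then show ?thesis using assms by (simp add: excursion_gf_eq_weight)
qed

section \<open>Power series in two catalytic variables\<close>

text \<open>Series in \<open>x\<close> and \<open>y\<close> over a ring of coefficients are iterated power series whose outer variable is
\<open>y\<close>. A series in \<open>x\<close> alone is then embedded by \<^const>\<open>fps_const\<close>, and the function \<open>in_y\<close>
takes a series in one variable and renames that variable to \<open>y\<close>.\<close>

definition in_y :: "'a::comm_ring_1 fps \<Rightarrow> 'a fps fps" where
  "in_y p = Abs_fps (\<lambda>j. fps_const (p $ j))"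

lemma in_y_nth [simp]: "in_y p $ j = fps_const (p $ j)"
  by (simp add: in_y_def)

lemma fps_const_sum: "fps_const (sum f S) = (\<Sum>i\<in>S. fps_const (f i :: 'a::comm_ring_1))"
  by (induction S rule: infinite_finite_induct) (auto simp flip: fps_const_add)

lemma in_y_add: "in_y (p + q) = in_y p + in_y q"
  and in_y_diff: "in_y (p - q) = in_y p - in_y q"
  and in_y_mult: "in_y (p * q) = in_y p * in_y q"
  and in_y_const: "in_y (fps_const c) = fps_const (fps_const c)"
  and in_y_X: "in_y fps_X = fps_X"
  and in_y_1: "in_y 1 = 1"
  by (auto simp: fps_eq_iff fps_mult_nth fps_const_sum fps_X_def fps_one_def)

text \<open>This is \<open>x y (1 - T (x + y + 1/(x y)))\<close>, the step polynomial of the reverse Kreweras model with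
its denominator cleared.\<close>

definition kernel :: "'a::comm_ring_1 \<Rightarrow> 'a fps fps" where
  "kernel T = (let x = fps_const fps_X; y = fps_X; t = fps_const (fps_const T)
    in x * y - t * x ^ 2 * y - t * x * y ^ 2 - t)"

lemma kernel_mult_nth_Suc_Suc:
  "(kernel T * N) $ Suc j $ Suc i = N $ j $ i - T * (if i = 0 then 0 else N $ j $ (i - 1))
     - T * (if j = 0 then 0 else N $ (j - 1) $ i) - T * N $ Suc j $ Suc i"
proof -
  have *: "kernel T * N = fps_X * (fps_const fps_X * N)
     - fps_const (fps_const T) * (fps_X * (fps_const fps_X * (fps_const fps_X * N)))
     - fps_const (fps_const T) * (fps_X * (fps_X * (fps_const fps_X * N)))
     - fps_const (fps_const T) * N"
    by (simp add: kernel_def Let_def algebra_simps power2_eq_square)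
  show ?thesis unfolding * by (simp add: fps_X_mult_nth)
qed

lemma kernel_mult_nth_0:
  "(kernel T * N) $ 0 $ i = - T * N $ 0 $ i"
  "(kernel T * N) $ j $ 0 = - T * N $ j $ 0"
proof -
  have *: "kernel T * N = fps_X * (fps_const fps_X * N)
     - fps_const (fps_const T) * (fps_X * (fps_const fps_X * (fps_const fps_X * N)))
     - fps_const (fps_const T) * (fps_X * (fps_X * (fps_const fps_X * N)))
     - fps_const (fps_const T) * N"
    by (simp add: kernel_def Let_def algebra_simps power2_eq_square)
  show "(kernel T * N) $ 0 $ i = - T * N $ 0 $ i" unfolding * by simp
  show "(kernel T * N) $ j $ 0 = - T * N $ j $ 0" unfolding * 
    by (simp add: fps_X_mult_nth)
qed

lemma fps_mult_nth_eq_0: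
  fixes T :: "'a::comm_ring_1 fps"
  assumes "T $ 0 = 0" "\<And>m. m < n \<Longrightarrow> f $ m = 0"
  shows "(T * f) $ n = 0"
  unfolding fps_mult_nth
proof (rule sum.neutral, safe)
  fix i assume "i \<in> {0..n}"
  then show "T $ i * f $ (n - i) = 0"
    using assms by (cases "i = 0") auto
qed

text \<open>The right-hand side has no monomial \<open>x\<^bsup>i+1\<^esup> y\<^bsup>j+1\<^esup>\<close>. On the left such a monomial
carries the \<open>(i,j)\<close> coefficient of \<open>N\<close> minus \<open>T\<close> times other coefficients of \<open>N\<close>. Since \<open>T\<close> has no
constant term, all coefficients of \<open>N\<close> vanish by induction on the order in the innermost variable.\<close>

lemma kernel_multiple_separated:
  fixes T :: "'a::comm_ring_1 fps"
  assumes T: "T $ 0 = 0" and eq: "kernel T * N = fps_const p - in_y q"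
  shows "N = 0"
proof -
  have rec: "N $ j $ i = T * (if i = 0 then 0 else N $ j $ (i - 1))
     + T * (if j = 0 then 0 else N $ (j - 1) $ i) + T * N $ Suc j $ Suc i" for i j
  proof -
    have aux: "c - p - q - r = 0 \<Longrightarrow> c = p + q + r" for c p q r :: "'a fps"
      by (simp add: algebra_simps)
    have "(kernel T * N) $ Suc j $ Suc i = 0" by (simp add: eq)
    then show ?thesis unfolding kernel_mult_nth_Suc_Suc by (rule aux)
  qed
  have "N $ j $ i $ n = 0" for i j n
  proof (induction n arbitrary: i j rule: less_induct)
    case (less n)
    have "(T * N $ j $ i) $ n = 0" for i j
      by (rule fps_mult_nth_eq_0[OF T]) (rule less.IH)
    then show ?case by (subst rec) (simp add: T)
  qed
  then show ?thesis by (simp add: fps_eq_iff)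
qed

lemma separated_imp_const:
  assumes "fps_const p = in_y q"
  shows "p = fps_const (q $ 0)"
  using arg_cong[OF assms, of "\<lambda>f. f $ 0"] by simp

lemma fps_shift_1_mult_X: "fps_X * fps_shift 1 f = f - fps_const (f $ 0)"
  for f :: "'a::comm_ring_1 fps"
  by (rule fps_ext) (simp add: fps_X_mult_nth)

abbreviation scalar :: "'a::comm_ring_1 \<Rightarrow> 'a fps fps" where
  "scalar c \<equiv> fps_const (fps_const c)"

abbreviation var_x :: "'a::comm_ring_1 fps fps" where "var_x \<equiv> fps_const fps_X"
abbreviation var_y :: "'a::comm_ring_1 fps fps" where "var_y \<equiv> fps_X"

definition shift_x :: "'a::comm_ring_1 fps fps \<Rightarrow> 'a fps fps" where
  "shift_x Q = Abs_fps (\<lambda>j. fps_shift 1 (Q $ j))"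

lemma var_x_mult_shift_x: "var_x * shift_x Q = Q - in_y (Abs_fps (\<lambda>j. Q $ j $ 0))"
  by (rule fps_ext) (simp add: shift_x_def fps_shift_1_mult_X[unfolded One_nat_def])

text \<open>A symmetric solution \<open>Q\<close> of the functional equation; the series of boundary walks is the
coefficient \<open>Q $ 0\<close>, the series of excursions is \<open>Q $ 0 $ 0\<close>.\<close>

definition walk_equation :: "'a::comm_ring_1 \<Rightarrow> 'a \<Rightarrow> 'a \<Rightarrow> 'a fps fps \<Rightarrow> bool" where
  "walk_equation T \<alpha> \<kappa> Q \<longleftrightarrow>
     (\<forall>j. Q $ j $ 0 = Q $ 0 $ j) \<and>
     kernel T * Q = (scalar \<alpha> * var_x * var_y - scalar T)
        * (fps_const (Q $ 0) + in_y (Q $ 0) - scalar (Q $ 0 $ 0)) + scalar \<kappa> * var_x * var_y"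

section \<open>The functional equation of the walks\<close>

text \<open>The length variable is replaced by \<open>T\<close> from the start, so that the same results serve for
\<open>T = t\<close> and for \<open>T = s\<^sup>2\<close>.\<close>

definition endpoint_series :: "'k::field \<Rightarrow> 'k fps \<Rightarrow> int \<times> int \<Rightarrow> 'k fps" where
  "endpoint_series a T p = Abs_fps (\<lambda>n. weight reverse_kreweras_steps a n p) oo T"

definition walk_series :: "'k::field \<Rightarrow> 'k fps \<Rightarrow> 'k fps fps fps" where
  "walk_series a T = Abs_fps (\<lambda>j. Abs_fps (\<lambda>i. endpoint_series a T (int i, int j)))"

lemma weight_reverse_kreweras_Suc:
  "weight reverse_kreweras_steps a (Suc n) (i, j) =
    (if 0 \<le> i \<and> 0 \<le> j then arrival_weight a (i, j) * (weight reverse_kreweras_steps a n (i - 1, j)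
       + weight reverse_kreweras_steps a n (i, j - 1) + weight reverse_kreweras_steps a n (i + 1, j + 1)) else 0)"
  by (subst weight_Suc) (auto simp: reverse_kreweras_steps_def in_quadrant_def algebra_simps)

lemma weight_reverse_kreweras_swap:
  "weight reverse_kreweras_steps a n (i, j) = weight reverse_kreweras_steps a n (j, i)"
proof (induction n arbitrary: i j)
  case (Suc n)
  show ?case unfolding weight_reverse_kreweras_Suc
    by (subst (1 2 3) Suc.IH) (auto simp: arrival_weight_def algebra_simps)
qed (simp add: weight_0)

lemma endpoint_series_swap: "endpoint_series a T (i, j) = endpoint_series a T (j, i)"
  by (simp add: endpoint_series_def weight_reverse_kreweras_swap[of a _ i j])

lemma endpoint_series_outside: "i < 0 \<or> j < 0 \<Longrightarrow> endpoint_series a T (i, j) = 0"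
  by (auto simp: endpoint_series_def weight_outside in_quadrant_def fps_zero_def[symmetric])

lemma endpoint_series_rec:
  assumes T: "T $ 0 = 0" and ij: "0 \<le> i" "0 \<le> j"
  shows "endpoint_series a T (i, j) = (if i = 0 \<and> j = 0 then 1 else 0) +
    fps_const (arrival_weight a (i, j)) * T * (endpoint_series a T (i - 1, j)
       + endpoint_series a T (i, j - 1) + endpoint_series a T (i + 1, j + 1))"
proof -
  let ?W = "\<lambda>p. Abs_fps (\<lambda>n. weight reverse_kreweras_steps a n p)"
  have "?W (i, j) = (if i = 0 \<and> j = 0 then 1 else 0) +
    fps_const (arrival_weight a (i, j)) * (fps_X * (?W (i - 1, j) + ?W (i, j - 1) + ?W (i + 1, j + 1)))"
  proof (rule fps_ext)
    fix n show "?W (i, j) $ n = ((if i = 0 \<and> j = 0 then 1 else 0) +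
    fps_const (arrival_weight a (i, j)) * (fps_X * (?W (i - 1, j) + ?W (i, j - 1) + ?W (i + 1, j + 1)))) $ n"
      using ij by (cases n) (auto simp: weight_0 weight_reverse_kreweras_Suc)
  qed
  from arg_cong[OF this, of "\<lambda>f. f oo T"] show ?thesis
    using T by (auto simp: endpoint_series_def fps_compose_add_distrib fps_compose_mult_distrib mult.assoc)
qed

text \<open>If \<open>z\<close> counts the arrivals at a boundary point before the last visit is weighted, the difference
\<open>q - z\<close> can be written in terms of the weighted series \<open>q\<close> only. The second case is the
origin, where the weight is \<open>a\<^sup>2\<close> and the empty walk is added.\<close>

lemma weighted_cases:
  fixes a :: "'k::field"
  assumes "a \<noteq> 0"
  shows "(q :: 'k fps) = fps_const a * z \<Longrightarrow> q - z = fps_const (1 - 1 / a) * q"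
    and "(q :: 'k fps) = 1 + fps_const (a * a) * z \<Longrightarrow> q - z = fps_const (1 - 1 / a) * q + (fps_const (1 / a^2) + fps_const ((1 - 1 / a) / a) * q)"
proof -
  show "q - z = fps_const (1 - 1 / a) * q" if "q = fps_const a * z"
  proof (rule fps_ext)
    fix n show "(q - z) $ n = (fps_const (1 - 1 / a) * q) $ n"
      unfolding that using assms by (simp add: field_simps)
  qed
  show "q - z = fps_const (1 - 1 / a) * q + (fps_const (1 / a^2) + fps_const ((1 - 1 / a) / a) * q)" if "q = 1 + fps_const (a * a) * z"
  proof (rule fps_ext)
    fix n show "(q - z) $ n = (fps_const (1 - 1 / a) * q + (fps_const (1 / a^2) + fps_const ((1 - 1 / a) / a) * q)) $ n"
      unfolding that using assms by (auto simp: field_simps power2_eq_square)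
  qed
qed

text \<open>Coefficient by coefficient this is \<open>endpoint_series_rec\<close>: the monomials divisible by \<open>x y\<close> give
the recurrence, with the boundary weights rewritten by \<open>weighted_cases\<close>, and on the others both sides
are \<open>-T\<close> times a boundary coefficient of \<open>Q\<close>.\<close>

lemma walk_series_equation:
  fixes T :: "'k::field fps"
  assumes T: "T $ 0 = 0" and a: "a \<noteq> 0"
  shows "walk_equation T (fps_const (1 - 1 / a))
     (fps_const (1 / a^2) + fps_const ((1 - 1 / a) / a) * walk_series a T $ 0 $ 0) (walk_series a T)"
proof -
  define Q where "Q = walk_series a T"
  define \<alpha> where "\<alpha> = fps_const (1 - 1 / a)"
  define \<kappa> where "\<kappa> = fps_const (1 / a^2) + fps_const ((1 - 1 / a) / a) * Q $ 0 $ 0"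
  have nth: "Q $ j $ i = endpoint_series a T (int i, int j)" for i j
    by (simp add: Q_def walk_series_def)
  have sym: "Q $ j $ i = Q $ i $ j" for i j unfolding nth by (rule endpoint_series_swap)
  define U where "U = fps_const (Q $ 0) + in_y (Q $ 0) - scalar (Q $ 0 $ 0)"
  have U: "U $ j $ i = (if j = 0 then Q $ 0 $ i else 0) + (if i = 0 then Q $ 0 $ j else 0)
      - (if i = 0 \<and> j = 0 then Q $ 0 $ 0 else 0)" for i j
    by (simp add: U_def)
  have U_left: "U $ j $ 0 = Q $ j $ 0" for j by (simp add: U sym[of j 0])
  have U_bottom: "U $ 0 $ i = Q $ 0 $ i" for i by (simp add: U)
  define z where "z i j = T * (if i = 0 then 0 else Q $ j $ (i - 1))
     + T * (if j = 0 then 0 else Q $ (j - 1) $ i) + T * Q $ Suc j $ Suc i" for i j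
  have rec: "Q $ j $ i = (if i = 0 \<and> j = 0 then 1 else 0) + fps_const (arrival_weight a (int i, int j)) * z i j" for i j
    unfolding nth z_def using endpoint_series_rec[OF T, of "int i" "int j" a]
    by (auto simp: endpoint_series_outside of_nat_diff algebra_simps)
  have "kernel T * Q = (scalar \<alpha> * var_x * var_y - scalar T) * U + scalar \<kappa> * var_x * var_y" (is "_ = ?rhs")
  proof (rule fps_ext, rule fps_ext)
    fix j i
    have rhs: "?rhs = scalar \<alpha> * (var_y * (var_x * U)) - scalar T * U + scalar \<kappa> * (var_y * var_x)"
      by (simp only: algebra_simps)
    consider "i = 0" | "j = 0" | i' j' where "i = Suc i'" "j = Suc j'" by (metis not0_implies_Suc)
    then show "(kernel T * Q) $ j $ i = ?rhs $ j $ i"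
    proof cases
      case 1
      then show ?thesis unfolding rhs 1 kernel_mult_nth_0 by (simp add: U_left fps_X_mult_nth)
    next
      case 2
      then show ?thesis unfolding rhs 2 kernel_mult_nth_0 by (simp add: U_bottom)
    next
      case 3
      have "(kernel T * Q) $ j $ i = Q $ j' $ i' - z i' j'"
        unfolding 3 kernel_mult_nth_Suc_Suc z_def by (simp add: algebra_simps)
      also have "\<dots> = \<alpha> * U $ j' $ i' + (if i' = 0 \<and> j' = 0 then \<kappa> else 0)"
      proof (cases "i' = 0 \<or> j' = 0")
        case False
        then show ?thesis using rec[of j' i'] by (simp add: U arrival_weight_def)
      next
        case boundary: True
        show ?thesis
        proof (cases "i' = 0 \<and> j' = 0")
          case True
          then have "Q $ 0 $ 0 = 1 + fps_const (a * a) * z 0 0"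
            using rec[of 0 0] by (simp add: arrival_weight_def)
          from weighted_cases(2)[OF a this] show ?thesis
            using True by (simp add: U \<alpha>_def \<kappa>_def)
        next
          case False
          then have "Q $ j' $ i' = fps_const a * z i' j'"
            using rec[of j' i'] boundary by (auto simp: arrival_weight_def)
          from weighted_cases(1)[OF a this] show ?thesis
            using False boundary by (auto simp: U \<alpha>_def sym[of j' 0])
        qed
      qed
      also have "\<dots> = ?rhs $ j $ i"
      proof -
        have "U $ Suc j' $ Suc i' = 0" by (simp add: U)
        then show ?thesis unfolding rhs 3 by simp
      qed
      finally show ?thesis .
    qed
  qed
  then show ?thesis
    using sym unfolding walk_equation_def Q_def \<alpha>_def \<kappa>_def U_def by blast
qed

section \<open>Substituting a series for a catalytic variable\<close>

text \<open>The value \<open>f(X)\<close> of a series \<open>f(x)\<close> at a series \<open>X\<close> without constant term. The terms beyond \<open>m = n\<close> do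
not contribute to the \<open>n\<close>-th coefficient. The substitution is not an instance of \<^const>\<open>fps_compose\<close>,
as \<open>X\<close> lives in the coefficient ring of \<open>f\<close>.\<close>

definition eval_at :: "'a::comm_ring_1 fps \<Rightarrow> 'a fps fps \<Rightarrow> 'a fps" where
  "eval_at X f = Abs_fps (\<lambda>n. \<Sum>m\<le>n. (f $ m * X ^ m) $ n)"

lemma fps_mult_power_nth_less:
  fixes X :: "'a::comm_ring_1 fps"
  assumes "X $ 0 = 0" "n < m" shows "(f * X ^ m) $ n = 0"
  using assms by (auto simp: fps_mult_nth startsby_zero_power_prefix intro!: sum.neutral)

lemma eval_at_nth:
  fixes X :: "'a::comm_ring_1 fps"
  assumes "X $ 0 = 0" "n \<le> N"
  shows "eval_at X f $ n = (\<Sum>m\<le>N. f $ m * X ^ m) $ n"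
proof -
  have "(\<Sum>m\<le>N. (f $ m * X ^ m) $ n) = (\<Sum>m\<le>n. (f $ m * X ^ m) $ n)"
    using assms by (intro sum.mono_neutral_right) (auto simp: fps_mult_power_nth_less)
  then show ?thesis by (simp add: eval_at_def fps_sum_nth)
qed

lemma eval_at_shift:
  fixes X :: "'a::comm_ring_1 fps"
  assumes X: "X $ 0 = 0"
  shows "eval_at X f = f $ 0 + X * eval_at X (fps_shift 1 f)"
proof (rule fps_ext)
  fix n
  have "(X * eval_at X (fps_shift 1 f)) $ n = (X * (\<Sum>m\<le>n. fps_shift 1 f $ m * X ^ m)) $ n"
    unfolding fps_mult_nth by (intro sum.cong) (auto simp: eval_at_nth[OF X, of _ n])
  also have "X * (\<Sum>m\<le>n. fps_shift 1 f $ m * X ^ m) = (\<Sum>m\<le>n. f $ Suc m * X ^ Suc m)"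
    by (simp add: sum_distrib_left algebra_simps)
  also have "\<dots> = (\<Sum>m\<le>Suc n. f $ m * X ^ m) - f $ 0"
    by (subst sum.atMost_Suc_shift) simp
  finally show "eval_at X f $ n = (f $ 0 + X * eval_at X (fps_shift 1 f)) $ n"
    using eval_at_nth[OF X, of n "Suc n" f] by simp
qed

text \<open>Division by \<open>x - X\<close> with remainder; the quotient has the values at \<open>X\<close> of the shifted series as its
coefficients, since \<open>f(X) = f\<^sub>0 + X (f\<^sub>1 + f\<^sub>2 X + \<dots>)\<close>.\<close>

lemma eval_at_remainder:
  fixes X :: "'a::comm_ring_1 fps"
  assumes X: "X $ 0 = 0"
  obtains V where "f = (fps_X - fps_const X) * V + fps_const (eval_at X f)"
proof
  define V where "V = Abs_fps (\<lambda>j. eval_at X (fps_shift (Suc j) f))"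
  have V: "eval_at X (fps_shift j f) = f $ j + X * V $ j" for j
    using eval_at_shift[OF X, of "fps_shift j f"] by (simp add: V_def flip: fps_shift_fps_shift)
  show "f = (fps_X - fps_const X) * V + fps_const (eval_at X f)"
  proof (rule fps_ext)
    fix j show "f $ j = ((fps_X - fps_const X) * V + fps_const (eval_at X f)) $ j"
    proof (cases j)
      case 0 then show ?thesis using V[of 0] by (simp add: left_diff_distrib)
    next
      case (Suc i) then show ?thesis using V[of j]
        by (simp add: left_diff_distrib V_def)
    qed
  qed
qed

text \<open>If \<open>(x - X) V\<close> is constant, then \<open>V\<^sub>0 = X\<^sup>j V\<^sub>j\<close> for every \<open>j\<close>, so \<open>V\<^sub>0\<close> has
infinite order and vanishes. Remainders modulo \<open>x - X\<close> are therefore unique, which makes evaluation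
a ring homomorphism.\<close>

lemma eval_at_linear_multiple:
  fixes X :: "'a::comm_ring_1 fps"
  assumes X: "X $ 0 = 0" and eq: "(fps_X - fps_const X) * V = fps_const c"
  shows "c = 0"
proof -
  have step: "V $ j = X * V $ Suc j" for j
    using arg_cong[OF eq, of "\<lambda>f. f $ Suc j"] by (simp add: left_diff_distrib)
  have pow: "V $ 0 = X ^ j * V $ j" for j
    by (induction j) (auto simp: step[symmetric] mult.assoc, metis step mult.left_commute)
  have "V $ 0 $ n = 0" for n
    using fps_mult_power_nth_less[OF X, of n "Suc n" "V $ Suc n"] pow[of "Suc n"]
    by (simp add: mult.commute)
  then have "V $ 0 = 0" by (simp add: fps_eq_iff)
  then show ?thesis using arg_cong[OF eq, of "\<lambda>f. f $ 0"] by (simp add: left_diff_distrib)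
qed

lemma eval_at_eqI:
  fixes X :: "'a::comm_ring_1 fps"
  assumes X: "X $ 0 = 0" and "f = (fps_X - fps_const X) * V + fps_const c"
  shows "eval_at X f = c"
proof -
  obtain W where W: "f = (fps_X - fps_const X) * W + fps_const (eval_at X f)"
    using eval_at_remainder[OF X] .
  define e where "e = eval_at X f"
  have "(fps_X - fps_const X) * (V - W) = fps_const (e - c)"
    using assms(2) W unfolding e_def[symmetric] by (simp add: algebra_simps flip: fps_const_sub)
  from eval_at_linear_multiple[OF X this] show ?thesis by (simp add: e_def)
qed

lemma eval_at_simps:
  fixes X :: "'a::comm_ring_1 fps"
  assumes X: "X $ 0 = 0"
  shows "eval_at X (f + g) = eval_at X f + eval_at X g"
    and "eval_at X (f - g) = eval_at X f - eval_at X g"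
    and "eval_at X (f * g) = eval_at X f * eval_at X g"
    and "eval_at X (fps_const c) = c"
    and "eval_at X fps_X = X"
proof -
  obtain V where V: "f = (fps_X - fps_const X) * V + fps_const (eval_at X f)"
    using eval_at_remainder[OF X] .
  obtain W where W: "g = (fps_X - fps_const X) * W + fps_const (eval_at X g)"
    using eval_at_remainder[OF X] .
  define e h where "e = eval_at X f" and "h = eval_at X g"
  note V = V[folded e_def] and W = W[folded h_def]
  show "eval_at X (f + g) = eval_at X f + eval_at X g"
    by (rule eval_at_eqI[OF X, where V = "V + W"], fold e_def h_def, subst V, subst W)
       (simp add: algebra_simps flip: fps_const_add)
  show "eval_at X (f - g) = eval_at X f - eval_at X g"
    by (rule eval_at_eqI[OF X, where V = "V - W"], fold e_def h_def, subst V, subst W)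
       (simp add: algebra_simps flip: fps_const_sub)
  show "eval_at X (f * g) = eval_at X f * eval_at X g"
  proof (rule eval_at_eqI[OF X, where V = "V * g + fps_const e * W"], fold e_def h_def)
    have "f * g = (fps_X - fps_const X) * V * g + fps_const e * g"
      by (subst V) (simp add: algebra_simps)
    also have "fps_const e * g = fps_const e * (fps_X - fps_const X) * W + fps_const (e * h)"
      by (subst W) (simp add: algebra_simps flip: fps_const_mult)
    finally show "f * g = (fps_X - fps_const X) * (V * g + fps_const e * W) + fps_const (e * h)"
      by (simp add: algebra_simps)
  qed
  show "eval_at X (fps_const c) = c" by (rule eval_at_eqI[OF X, where V = 0]) simp
  show "eval_at X fps_X = X" by (rule eval_at_eqI[OF X, where V = 1]) simp
qed

lemma eval_at_nth_0: "X $ 0 = 0 \<Longrightarrow> eval_at X f $ 0 = f $ 0 $ 0"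
  by (simp add: eval_at_def)

section \<open>The boundary series without weights\<close>

lemma fps_X_mult_cancel: "fps_X * f = fps_X * g \<Longrightarrow> f = (g :: 'a::idom fps)"
  using mult_left_cancel[of fps_X f g] by simp

text \<open>Behind this identity are the two invariants \<open>i(x) = t\<^sup>2 R(x) - x + t x\<^sup>2\<close> and
\<open>J(x) = 1/x + x/t - x\<^sup>2\<close>: modulo the kernel, \<open>J(x) = J(y)\<close> and
\<open>i(x) = t\<^sup>2 (G - R(y)) - t/y\<close>. The combination \<open>(i(x) - t\<^sup>2 G) (t J(x) + i(x))\<close> has no pole at
\<open>x = 0\<close>, and its counterpart in \<open>y\<close> has none at \<open>y = 0\<close>; here it appears divided by \<open>t\<close>. The letters
\<open>dx\<close>, \<open>dy\<close>, \<open>qx\<close>, \<open>qy\<close> are divided differences.\<close>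

lemma unweighted_identity:
  fixes x y t Q :: "'a::idom"
  assumes M: "M = x * y - t * x^2 * y - t * x * y^2 - t"
    and eq: "M * Q = x * y - t * (rx + ry - g)"
    and "x * dx = rx - g" "y * dy = ry - g" "y * qy = Q - rx" "x * qx = Q - ry"
  shows "x * (y * (t * M * (qy - qx - t * Q * (rx - ry)))) =
         x * (y * ((t^2 * dx - 1 + t * x) * (1 + t * x * rx) - (t^2 * dy - 1 + t * y) * (1 + t * y * ry)))"
proof -
  have "x * (y * (t * M * (qy - qx - t * Q * (rx - ry)))) =
     t * (x * M * (y * qy) - y * M * (x * qx) - t * x * y * (M * Q) * (rx - ry))" by algebra
  also have "\<dots> = t * (x * M * (Q - rx) - y * M * (Q - ry) - t * x * y * (M * Q) * (rx - ry))"
    using assms by simp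
  also have "\<dots> = t * ((x - y) * (M * Q) - M * (x * rx - y * ry) - t * x * y * (M * Q) * (rx - ry))"
    by algebra
  also have "\<dots> = y * (t^2 * (rx - g) - x + t * x^2) * (1 + t * x * rx)
      - x * (t^2 * (ry - g) - y + t * y^2) * (1 + t * y * ry)"
    unfolding eq unfolding M by algebra
  also have "\<dots> = y * (t^2 * (x * dx) - x + t * x^2) * (1 + t * x * rx)
      - x * (t^2 * (y * dy) - y + t * y^2) * (1 + t * y * ry)"
    using assms by simp
  also have "\<dots> = x * (y * ((t^2 * dx - 1 + t * x) * (1 + t * x * rx) - (t^2 * dy - 1 + t * y) * (1 + t * y * ry)))"
    by algebra
  finally show ?thesis .
qed

text \<open>An equation for \<open>R(x)\<close> alone, with \<open>y\<close> eliminated. The cofactor of the kernel in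
\<open>unweighted_identity\<close> vanishes, so the left-hand side does not depend on \<open>x\<close>.\<close>

lemma unweighted_boundary_equation:
  fixes T :: "'k::field fps"
  assumes T: "T $ 0 = 0" and Q: "walk_equation T 0 1 Q"
  defines "R \<equiv> Q $ 0"
  shows "(fps_const (T^2) * fps_shift 1 R - 1 + fps_const T * fps_X) * (1 + fps_const T * fps_X * R)
     = fps_const (T^2 * R $ 1 - 1)" (is "?p = _")
proof -
  define dR where "dR = fps_shift 1 R"
  have dR: "fps_X * dR = R - fps_const (R $ 0)" unfolding dR_def by (rule fps_shift_1_mult_X)
  have sym: "Abs_fps (\<lambda>j. Q $ j $ 0) = R"
    using Q by (auto simp: walk_equation_def fps_eq_iff R_def)
  let ?x = "var_x :: 'k fps fps fps" and ?y = "var_y :: 'k fps fps fps" and ?t = "scalar T"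
  \<comment> \<open>The cofactor of the kernel; its vanishing is a quadratic identity between the walk series.\<close>
  define n where "n = ?t * (fps_shift 1 Q - shift_x Q - ?t * Q * (fps_const R - in_y R))"
  have "?x * (?y * (?t * kernel T * (fps_shift 1 Q - shift_x Q - ?t * Q * (fps_const R - in_y R)))) =
        ?x * (?y * ((?t^2 * fps_const dR - 1 + ?t * ?x) * (1 + ?t * ?x * fps_const R)
          - (?t^2 * in_y dR - 1 + ?t * ?y) * (1 + ?t * ?y * in_y R)))"
  proof (rule unweighted_identity[where g = "scalar (R $ 0)"])
    show "kernel T = ?x * ?y - ?t * ?x^2 * ?y - ?t * ?x * ?y^2 - ?t"
      by (simp add: kernel_def Let_def)
    show "kernel T * Q = ?x * ?y - ?t * (fps_const R + in_y R - scalar (R $ 0))"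
    proof -
      have "kernel T * Q = (0 * ?x * ?y - ?t) * (fps_const R + in_y R - scalar (R $ 0)) + 1 * ?x * ?y"
        using Q unfolding walk_equation_def R_def fps_const_0_eq_0 fps_const_1_eq_1 by blast
      then show ?thesis by (simp only: mult_zero_left mult_1_left diff_0 mult_minus_left add.commute add_uminus_conv_diff)
    qed
    show "?x * fps_const dR = fps_const R - scalar (R $ 0)"
      unfolding fps_const_mult dR by simp
    show "?y * in_y dR = in_y R - scalar (R $ 0)"
      using arg_cong[OF dR, of in_y] by (simp only: in_y_mult in_y_X in_y_diff in_y_const)
    show "?y * fps_shift 1 Q = Q - fps_const R"
      unfolding R_def by (rule fps_shift_1_mult_X)
    show "?x * shift_x Q = Q - in_y R"
      using var_x_mult_shift_x[of Q] sym by simp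
  qed
  then have "kernel T * n = (?t^2 * fps_const dR - 1 + ?t * ?x) * (1 + ?t * ?x * fps_const R)
          - (?t^2 * in_y dR - 1 + ?t * ?y) * (1 + ?t * ?y * in_y R)"
    unfolding n_def by (simp only: mult.assoc mult_cancel_left) (simp add: mult_ac)
  also have "\<dots> = fps_const ?p - in_y ?p"
    by (simp only: in_y_mult in_y_add in_y_diff in_y_const in_y_X in_y_1 dR_def fps_const_power
          fps_const_1_eq_1 flip: fps_const_mult fps_const_add fps_const_sub)
  finally have eq: "kernel T * n = fps_const ?p - in_y ?p" .
  have "n = 0" by (rule kernel_multiple_separated[OF T eq])
  then have "?p = fps_const (?p $ 0)" using eq by (intro separated_imp_const) simp
  also have "?p $ 0 = T^2 * R $ 1 - 1" by simp
  finally show ?thesis .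
qed

text \<open>Modulo the kernel this series in \<open>x\<close> equals \<open>T\<^sup>2 (G - R(y)) - T/y\<close>, a function of \<open>y\<close> alone. It is
the invariant \<open>i(x)\<close> of the unweighted model.\<close>

definition boundary_invariant :: "'a::comm_ring_1 fps \<Rightarrow> 'a fps fps fps \<Rightarrow> 'a fps fps" where
  "boundary_invariant T S = fps_const (T^2) * S $ 0 - fps_X + fps_const T * fps_X ^ 2"

lemma eval_at_power: "X $ 0 = 0 \<Longrightarrow> eval_at X (f ^ n) = eval_at X f ^ n"
  using eval_at_simps(4)[of X 1] by (induction n) (simp_all add: eval_at_simps)

lemma quadratic_identity:
  fixes x t R :: "'a::idom"
  assumes "(t^2 * dR - 1 + t * x) * (1 + t * x * R) = c" "x * dR = R - g"
    "i = t^2 * R - x + t * x^2"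
  shows "(i - t^2 * g) * (t + x^2 - t * x^3 + x * i) = t * c * x"
proof -
  have "t * c * x = (t^2 * (x * dR) - x + t * x^2) * (t * (1 + t * x * R))"
    unfolding assms(1)[symmetric] by algebra
  also have "\<dots> = (i - t^2 * g) * (t + x^2 - t * x^3 + x * i)"
    unfolding assms(2,3) by algebra
  finally show ?thesis ..
qed

lemma invariant_quadratic:
  fixes T :: "'k::field fps"
  assumes T: "T $ 0 = 0" and S: "walk_equation T 0 1 S"
  defines "i \<equiv> boundary_invariant T S"
  shows "(i - fps_const (T^2 * S $ 0 $ 0)) * (fps_const T + fps_X^2 - fps_const T * fps_X^3 + fps_X * i)
     = fps_const (T * (T^2 * S $ 0 $ 1 - 1)) * fps_X"
proof -
  have "(i - fps_const T^2 * fps_const (S $ 0 $ 0)) * (fps_const T + fps_X^2 - fps_const T * fps_X^3 + fps_X * i)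
     = fps_const T * fps_const (T^2 * S $ 0 $ 1 - 1) * fps_X"
  proof (rule quadratic_identity)
    show "(fps_const T^2 * fps_shift 1 (S $ 0) - 1 + fps_const T * fps_X) * (1 + fps_const T * fps_X * S $ 0)
      = fps_const (T^2 * S $ 0 $ 1 - 1)"
      using unweighted_boundary_equation[OF T S] by (simp only: fps_const_power)
    show "fps_X * fps_shift 1 (S $ 0) = S $ 0 - fps_const (S $ 0 $ 0)" by (rule fps_shift_1_mult_X)
    show "i = fps_const T^2 * S $ 0 - fps_X + fps_const T * fps_X^2"
      unfolding i_def boundary_invariant_def by (simp only: fps_const_power)
  qed
  then show ?thesis by (simp only: fps_const_power fps_const_mult)
qed

text \<open>The quadratic equation for the invariant and its derivative with respect to \<open>x\<close>, both taken at \<open>x = X\<close>.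
The third part ensures \<open>i'(X) \<noteq> 0\<close>.\<close>

lemma invariant_quadratic_at:
  fixes T :: "'k::field fps"
  assumes T: "T $ 0 = 0" and S: "walk_equation T 0 1 S" and X: "X $ 0 = 0"
  defines "i \<equiv> boundary_invariant T S"
  defines "g \<equiv> T^2 * S $ 0 $ 0" and "c \<equiv> T * (T^2 * S $ 0 $ 1 - 1)"
    and "L \<equiv> T + X^2 - T * X^3" and "I \<equiv> eval_at X i" and "I' \<equiv> eval_at X (fps_deriv i)"
  shows "(I - g) * (L + X * I) = c * X"
    and "I' * (L + X * I) + (I - g) * (2 * X - 3 * T * X^2 + I + X * I') = c"
    and "I' $ 0 = -1"
proof -
  let ?t = "fps_const T" and ?x = "fps_X :: 'k fps fps"
  have eq: "(i - fps_const g) * (?t + ?x^2 - ?t * ?x^3 + ?x * i) = fps_const c * ?x"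
    unfolding i_def g_def c_def by (rule invariant_quadratic[OF T S])
  show "(I - g) * (L + X * I) = c * X"
    using arg_cong[OF eq, of "eval_at X"] unfolding I_def L_def
    by (simp only: eval_at_simps[OF X] eval_at_power[OF X])
  have num: "eval_at X (numeral n) = numeral n" for n
    using eval_at_simps(4)[OF X, of "numeral n"] by (simp only: numeral_fps_const[symmetric])
  have der: "fps_deriv (?t + ?x^2 - ?t * ?x^3 + ?x * i) = 2 * ?x - 3 * ?t * ?x^2 + i + ?x * fps_deriv i"
    by (simp add: fps_deriv_power power2_eq_square power3_eq_cube algebra_simps)
  have "fps_deriv i * (?t + ?x^2 - ?t * ?x^3 + ?x * i) +
     (i - fps_const g) * (2 * ?x - 3 * ?t * ?x^2 + i + ?x * fps_deriv i) = fps_const c"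
    using arg_cong[OF eq, of fps_deriv] unfolding fps_deriv_mult[of "i - fps_const g"] der
    by (simp add: algebra_simps)
  from arg_cong[OF this, of "eval_at X"]
  show "I' * (L + X * I) + (I - g) * (2 * X - 3 * T * X^2 + I + X * I') = c"
    unfolding I_def L_def I'_def by (simp only: eval_at_simps[OF X] eval_at_power[OF X] num)
  show "I' $ 0 = -1"
    unfolding I'_def eval_at_nth_0[OF X] i_def boundary_invariant_def
    using T by (simp add: power2_eq_square fps_deriv_power)
qed

text \<open>Write the quadratic equation as \<open>P(x, i) = 0\<close> with \<open>P\<close> having coefficients in \<open>x\<close>. At
\<open>X\<close> the derivative of the equation reduces to \<open>i'(X) \<partial>P/\<partial>i = 0\<close>, because the equation for \<open>X\<close> says
that the derivative of \<open>1/x + x/T - x\<^sup>2\<close> vanishes there. As \<open>i'(X) \<noteq> 0\<close>, the root \<open>i(X)\<close> is double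
and the discriminant of \<open>P\<close> vanishes at \<open>X\<close>.\<close>

lemma invariant_at_critical_point:
  fixes T :: "'k::field fps"
  assumes T: "T $ 0 = 0" and S: "walk_equation T 0 1 S"
    and X: "X $ 0 = 0" "X \<noteq> 0" "X^2 = T + 2 * T * X^3"
  shows "(2 * X - 3 * T * X^2 + T^2 * S $ 0 $ 0)^2 = - 4 * (T * (T^2 * S $ 0 $ 1 - 1))"
proof -
  define g where "g = T^2 * S $ 0 $ 0"
  define c where "c = T * (T^2 * S $ 0 $ 1 - 1)"
  define I where "I = eval_at X (boundary_invariant T S)"
  define I' where "I' = eval_at X (fps_deriv (boundary_invariant T S))"
  note F = invariant_quadratic_at[OF T S X(1), folded g_def c_def I_def I'_def]
  have "I' \<noteq> 0" using F(3) by auto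
  have "X * I' * (T + X^2 - T * X^3 + 2 * X * I - g * X) + (I - g) * (X^2 - T - 2 * T * X^3) = 0"
    using F(1,2) by algebra
  then have "T + X^2 - T * X^3 + 2 * X * I - g * X = 0"
    using X \<open>I' \<noteq> 0\<close> by simp
  then have "X^2 * ((2 * X - 3 * T * X^2 + g)^2 + 4 * c) = 0"
    using F(1) X(3) by algebra
  then have "(2 * X - 3 * T * X^2 + g)^2 + 4 * c = 0" using X(2) by simp
  then show ?thesis unfolding g_def c_def by (simp add: eq_neg_iff_add_eq_0)
qed

text \<open>At the two critical points \<open>X\<close> and \<open>Y\<close>, which start with \<open>s\<close> and \<open>-s\<close>, the vanishing discriminants
have the form \<open>(\<ell>(X) + g)\<^sup>2 = (\<ell>(Y) + g)\<^sup>2\<close> with \<open>\<ell>(X) \<noteq> \<ell>(Y)\<close>, which leaves only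
\<open>\<ell>(X) + g = -(\<ell>(Y) + g)\<close>.\<close>

lemma unweighted_coefficients:
  fixes T :: "'k::field fps"
  assumes T: "T $ 0 = 0" and S: "walk_equation T 0 1 S" and two: "(2::'k) \<noteq> 0"
    and X: "X $ 0 = 0" "X $ 1 = 1" "X^2 = T + 2 * T * X^3"
    and Y: "Y $ 0 = 0" "Y $ 1 = -1" "Y^2 = T + 2 * T * Y^3"
  shows "2 * (T^2 * S $ 0 $ 0) = - ((2 * X - 3 * T * X^2) + (2 * Y - 3 * T * Y^2))"
    and "(2 * X - 3 * T * X^2 + T^2 * S $ 0 $ 0)^2 = - 4 * (T * (T^2 * S $ 0 $ 1 - 1))"
proof -
  have "X \<noteq> 0" "Y \<noteq> 0" using X(2) Y(2) by auto
  note FX = invariant_at_critical_point[OF T S X(1) this(1) X(3)]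
   and FY = invariant_at_critical_point[OF T S Y(1) this(2) Y(3)]
  have X1: "(2 * X - 3 * T * X^2) $ 1 = 2" and Y1: "(2 * Y - 3 * T * Y^2) $ 1 = -2"
    using X Y T by (simp_all add: fps_mult_nth_1 mult.assoc power2_eq_square numeral_fps_const)
  have ne: "2 * X - 3 * T * X^2 \<noteq> 2 * Y - 3 * T * Y^2"
  proof
    assume "2 * X - 3 * T * X^2 = 2 * Y - 3 * T * Y^2"
    then have "(2::'k) = -2" using X1 Y1 by metis
    then have "(2::'k) * 2 = 0" by (simp add: eq_neg_iff_add_eq_0)
    then show False using two by (metis mult_eq_0_iff)
  qed
  have *: "2 * g = - (a + b)" if "(a + g)^2 = e" "(b + g)^2 = e" "a \<noteq> b" for a b g e :: "'k fps"
  proof -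
    have "(a - b) * (2 * g + (a + b)) = (a + g)^2 - (b + g)^2"
      by (simp add: power2_eq_square algebra_simps)
    then have "(a - b) * (2 * g + (a + b)) = 0" using that(1,2) by simp
    then have "2 * g + (a + b) = 0" using that(3) by simp
    then show ?thesis by (simp only: eq_neg_iff_add_eq_0)
  qed
  show "2 * (T^2 * S $ 0 $ 0) = - ((2 * X - 3 * T * X^2) + (2 * Y - 3 * T * Y^2))"
    using FX FY ne by (rule *)
  show "(2 * X - 3 * T * X^2 + T^2 * S $ 0 $ 0)^2 = - 4 * (T * (T^2 * S $ 0 $ 1 - 1))" by (rule FX)
qed

section \<open>The boundary series with weights\<close>

lemma fps_unit:
  fixes f :: "'a::comm_ring_1 fps"
  assumes "f $ 0 * c = 1"
  obtains g where "f * g = 1"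
  using fps_right_inverse[OF assms] by blast

text \<open>Modulo the kernel the weighted equation reads \<open>I(x) = J(y)\<close> with
\<open>I(x) = R(x) + \<alpha> A x (2 \<alpha> - 1 + t x) / D(x)\<close> and \<open>J(y) = g - R(y) + \<alpha> A / (\<alpha> - t y)\<close>,
where \<open>g\<close> is the weighted excursion series and \<open>\<kappa> = \<alpha> A\<close>. The function \<open>I\<close> has a pole at the root
\<open>X\<close> of \<open>D\<close>, and \<open>J(0) = A\<close>. With the unweighted pair \<open>i(x)\<close> and \<open>j(y)\<close>, where \<open>j\<close> has a simple
pole at \<open>0\<close>, the products \<open>(I(x) - A) (i(x) - i(X))\<close> and \<open>(J(y) - A) (j(y) - i(X))\<close> are free of
poles; they are the two terms on the right, and \<open>i0\<close> is \<open>i(X)\<close>. In the formula \<open>v\<close> and \<open>w\<close> are the inverses of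
\<open>D/(x - X)\<close> and of \<open>\<alpha> - t y\<close>, and \<open>Q'\<close> is the quotient that remains of \<open>Q\<close> once the denominators are cleared.\<close>

lemma weighted_identity:
  fixes x y t Q :: "'a::idom"
  assumes M: "M = x * y - t * x^2 * y - t * x * y^2 - t"
    and D: "D = \<alpha> * t * x^2 + \<alpha> * (\<alpha> - 1) * x + t^2"
    and MQ: "M * Q = (\<alpha> * x * y - t) * (rx + ry - g) + \<alpha> * A * x * y"
    and MS: "M * S = x * y - t * (sx + sy - h)"
    and w: "w * (\<alpha> - t * y) = 1"
    and u: "u * v = 1" "D = (x - X) * u"
    and V: "t^2 * sx - x + t * x^2 - i0 = (x - X) * V"
    and MQ': "M * Q' = D * (rx + ry - g) + \<alpha> * A * x * (\<alpha> - t * y)"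
    and dy: "y * dy = ry - g"
  shows "M * ((Q' + \<alpha> * A * t * w) * (V * v) - (A * t * w - dy) * (1 + t * y * S)) =
     (D * (rx - A) + \<alpha> * A * x * (2 * \<alpha> - 1 + t * x)) * V * v
     - (A * t * w - dy) * (t^2 * y * (h - sy) - t - y * i0)"
proof -
  define i where "i = t^2 * sx - x + t * x^2"
  define H where "H = D * (rx - A) + \<alpha> * A * x * (2 * \<alpha> - 1 + t * x)"
  define J where "J = A * t * w - dy"
  have F2: "M * (1 + t * y * S) = - y * i + (t^2 * y * (h - sy) - t)"
  proof -
    have "M * (1 + t * y * S) = M + t * y * (M * S)" by algebra
    also have "\<dots> = - y * i + (t^2 * y * (h - sy) - t)"
      unfolding MS unfolding M i_def by algebra
    finally show ?thesis .
  qed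
  have yJ: "y * J = \<alpha> * A * w - A - (ry - g)"
    unfolding J_def using w dy by algebra
  \<comment> \<open>Modulo the kernel, \<open>D\<close> is a multiple of \<open>\<alpha> - t y\<close>, which relates the denominators of \<open>I\<close> and \<open>J\<close>.\<close>
  have key: "(\<alpha> - t * y) * (x * (\<alpha> - 1 + t * x + t * y)) = D + t * M"
    unfolding D M by algebra
  have key': "x * (\<alpha> - 1 + t * x + t * y) = w * (D + t * M)"
    using key w by algebra
  have F3: "H - D * (y * J) = M * (Q' + \<alpha> * A * t * w)"
  proof -
    have "M * (Q' + \<alpha> * A * t * w) = M * Q' + \<alpha> * A * (w * (t * M))" by algebra
    also have "\<dots> = D * (rx + ry - g) + \<alpha> * A * x * (\<alpha> - t * y) + \<alpha> * A * (x * (\<alpha> - 1 + t * x + t * y) - w * D)"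
      unfolding MQ' key' by algebra
    also have "\<dots> = H - D * (y * J)" unfolding H_def yJ by algebra
    finally show ?thesis ..
  qed
  have DVv: "D * V * v = i - i0"
  proof -
    have "D * V * v = ((x - X) * V) * (u * v)" unfolding u(2) by algebra
    also have "\<dots> = i - i0" unfolding u(1) V[symmetric] i_def by simp
    finally show ?thesis .
  qed
  have "M * ((Q' + \<alpha> * A * t * w) * (V * v) - J * (1 + t * y * S)) =
      M * (Q' + \<alpha> * A * t * w) * (V * v) - J * (M * (1 + t * y * S))" by algebra
  also have "\<dots> = H * V * v - (y * J) * (D * V * v) - J * (- y * i + (t^2 * y * (h - sy) - t))"
    unfolding F3[symmetric] F2 by algebra
  also have "\<dots> = H * V * v - J * (t^2 * y * (h - sy) - t - y * i0)"
    unfolding DVv by algebra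
  finally show ?thesis unfolding J_def H_def .
qed

text \<open>By \<open>weighted_identity\<close> and \<open>kernel_multiple_separated\<close> the pole-free product of the weighted and the
unweighted invariants is a constant \<open>B\<close>. Multiplied by the unit \<open>u = D/(x - X)\<close> it becomes the
stated equation.\<close>

lemma weighted_boundary_equation:
  fixes T :: "'k::field fps"
  assumes T: "T $ 0 = 0" and \<alpha>: "\<alpha> = fps_const c" "c \<noteq> 0" "c \<noteq> 1"
    and Q: "walk_equation T \<alpha> (\<alpha> * A) Q" and S: "walk_equation T 0 1 S"
    and X: "X $ 0 = 0" "\<alpha> * T * X^2 + \<alpha> * (\<alpha> - 1) * X + T^2 = 0"
    and V: "boundary_invariant T S - fps_const i0 = (fps_X - fps_const X) * V"
  defines "D \<equiv> fps_const \<alpha> * fps_const T * fps_X ^ 2 + fps_const \<alpha> * (fps_const \<alpha> - 1) * fps_X + fps_const T ^ 2"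
  defines "u \<equiv> fps_const \<alpha> * fps_const T * fps_X + fps_const (\<alpha> * (\<alpha> - 1) + \<alpha> * T * X)"
  shows "\<exists>B. (D * (Q $ 0 - fps_const A) + fps_const \<alpha> * fps_const A * fps_X * (2 * fps_const \<alpha> - 1 + fps_const T * fps_X)) * V
      = fps_const B * u" (is "\<exists>B. ?H * V = _ B")
proof -
  define R where "R = Q $ 0"
  define dR where "dR = fps_shift 1 R"
  have dR: "fps_X * dR = R - fps_const (R $ 0)" unfolding dR_def by (rule fps_shift_1_mult_X)
  let ?x = "var_x :: 'k fps fps fps" and ?y = "var_y :: 'k fps fps fps" and ?t = "scalar T"
  let ?\<alpha> = "scalar \<alpha>"
  have "(\<alpha> * (\<alpha> - 1) + \<alpha> * T * X) $ 0 \<noteq> 0" using \<alpha> T by simp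
  then have "u $ 0 * inverse (\<alpha> * (\<alpha> - 1) + \<alpha> * T * X) = 1"
    by (simp add: u_def inverse_mult_eq_1')
  then obtain v where v: "u * v = 1" by (rule fps_unit)
  have "(?\<alpha> - ?t * ?y) $ 0 * scalar (1 / c) = 1"
    using \<alpha> by simp
  then obtain w where w: "(?\<alpha> - ?t * ?y) * w = 1" by (rule fps_unit)
  obtain w' where w': "(fps_const \<alpha> - fps_const T * fps_X) * w' = 1"
    by (rule fps_unit[of "fps_const \<alpha> - fps_const T * fps_X" "fps_const (1 / c)"]) (use \<alpha> in simp_all)
  have inv: "(?\<alpha> - ?t * ?y) * in_y w' = 1"
    using arg_cong[OF w', of in_y] by (simp only: in_y_mult in_y_X in_y_diff in_y_const in_y_1)
  have ww: "w = in_y w'"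
  proof -
    have "w * ((?\<alpha> - ?t * ?y) * in_y w') = ((?\<alpha> - ?t * ?y) * w) * in_y w'" by (simp only: mult_ac)
    then show ?thesis by (simp only: inv w mult_1_left mult_1_right)
  qed
  define J where "J = fps_const A * fps_const T * w' - dR"
  define P where "P = J * (fps_const T ^ 2 * fps_X * (fps_const (S $ 0 $ 0) - S $ 0) - fps_const T - fps_X * fps_const i0)"
  define Q' where "Q' = ?\<alpha> * fps_shift 1 Q - ?t * Q - ?\<alpha> * in_y dR"
  define N where "N = (Q' + ?\<alpha> * scalar A * ?t * w) * (fps_const V * fps_const v) - (scalar A * ?t * w - in_y dR) * (1 + ?t * ?y * S)"
  have MQ: "kernel T * Q = (?\<alpha> * ?x * ?y - ?t) * (fps_const R + in_y R - scalar (R $ 0)) + ?\<alpha> * scalar A * ?x * ?y"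
    using Q unfolding walk_equation_def R_def fps_const_mult[symmetric] by blast
  have dy: "?y * in_y dR = in_y R - scalar (R $ 0)"
    using arg_cong[OF dR, of in_y] by (simp only: in_y_mult in_y_X in_y_diff in_y_const)
  have kernel: "kernel T = ?x * ?y - ?t * ?x^2 * ?y - ?t * ?x * ?y^2 - ?t"
    by (simp add: kernel_def Let_def)
  have D: "fps_const D = ?\<alpha> * ?t * ?x^2 + ?\<alpha> * (?\<alpha> - 1) * ?x + ?t^2"
    unfolding D_def by (simp only: fps_const_power fps_const_1_eq_1 flip: fps_const_mult fps_const_add fps_const_sub)
  have u: "fps_const u = ?\<alpha> * ?t * ?x + (?\<alpha> * (?\<alpha> - 1) + ?\<alpha> * ?t * scalar X)"
    unfolding u_def by (simp only: fps_const_power fps_const_1_eq_1 flip: fps_const_mult fps_const_add fps_const_sub)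
  have X': "?\<alpha> * ?t * scalar X^2 + ?\<alpha> * (?\<alpha> - 1) * scalar X + ?t^2 = 0"
    using arg_cong[OF X(2), of scalar]
    by (simp only: fps_const_power fps_const_1_eq_1 fps_const_0_eq_0 flip: fps_const_mult fps_const_add fps_const_sub)
  have "kernel T * N = (fps_const D * (fps_const R - scalar A) + ?\<alpha> * scalar A * ?x * (2 * ?\<alpha> - 1 + ?t * ?x)) * fps_const V * fps_const v
     - (scalar A * ?t * w - in_y dR) * (?t^2 * ?y * (scalar (S $ 0 $ 0) - in_y (S $ 0)) - ?t - ?y * scalar i0)"
    unfolding N_def
  proof (rule weighted_identity[OF kernel D MQ _ _ _ _ _ _ dy])
    have "kernel T * S = (0 * ?x * ?y - ?t) * (fps_const (S$0) + in_y (S$0) - scalar (S $ 0 $ 0)) + 1 * ?x * ?y"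
      using S unfolding walk_equation_def fps_const_0_eq_0 fps_const_1_eq_1 by blast
    then show "kernel T * S = ?x * ?y - ?t * (fps_const (S$0) + in_y (S$0) - scalar (S $ 0 $ 0))" 
      by (simp only: mult_zero_left mult_1_left diff_0 mult_minus_left add.commute add_uminus_conv_diff)
    show "w * (?\<alpha> - ?t * ?y) = 1" using w by (simp only: mult.commute)
    show "fps_const u * fps_const v = 1" using v by (simp only: fps_const_mult fps_const_1_eq_1)
    have *: "D = (x - X) * u" if "D = a * t * x^2 + a * (a - 1) * x + t^2" "u = a * t * x + (a * (a - 1) + a * t * X)"
      "a * t * X^2 + a * (a - 1) * X + t^2 = 0" for D u a t x X :: "'k fps fps fps"
      using that by algebra
    show "fps_const D = (?x - scalar X) * fps_const u" using D u X' by (rule *)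
    show "?t^2 * fps_const (S $ 0) - ?x + ?t * ?x^2 - scalar i0 = (?x - scalar X) * fps_const V"
      using arg_cong[OF V, of fps_const] unfolding boundary_invariant_def
      by (simp only: fps_const_power fps_const_1_eq_1 flip: fps_const_mult fps_const_add fps_const_sub)
    have qy: "?y * fps_shift 1 Q = Q - fps_const R"
      unfolding R_def by (rule fps_shift_1_mult_X)
    \<comment> \<open>The defining equation of \<open>Q'\<close> is obtained after multiplication by \<open>y\<close>, which turns the divided
      differences into differences.\<close>
    have *: "y * (M * Q') = y * (D * (rx + ry - g) + \<alpha> * A * x * (\<alpha> - t * y))"
      if "M = x * y - t * x^2 * y - t * x * y^2 - t" "D = \<alpha> * t * x^2 + \<alpha> * (\<alpha> - 1) * x + t^2"
        "M * Q = (\<alpha> * x * y - t) * (rx + ry - g) + \<alpha> * A * x * y"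
        "y * qy = Q - rx" "y * dR = ry - g" "Q' = \<alpha> * qy - t * Q - \<alpha> * dR"
      for M Q x y t D \<alpha> A rx ry g qy dR Q' :: "'k fps fps fps"
    proof -
      have "y * (M * Q') = M * (\<alpha> * (y * qy) - t * y * Q - \<alpha> * (y * dR))" unfolding that(6) by algebra
      also have "\<dots> = (\<alpha> - t * y) * (M * Q) - \<alpha> * M * (rx + ry - g)" unfolding that(4,5) by algebra
      also have "\<dots> = y * (D * (rx + ry - g) + \<alpha> * A * x * (\<alpha> - t * y))"
        unfolding that(3) unfolding that(1,2) by algebra
      finally show ?thesis .
    qed
    have "?y * (kernel T * Q') = ?y * (fps_const D * (fps_const R + in_y R - scalar (R$0)) + ?\<alpha> * scalar A * ?x * (?\<alpha> - ?t * ?y))"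
      using kernel D MQ qy dy Q'_def by (rule *)
    then show "kernel T * Q' = fps_const D * (fps_const R + in_y R - scalar (R$0)) + ?\<alpha> * scalar A * ?x * (?\<alpha> - ?t * ?y)"
      by (rule fps_X_mult_cancel)
  qed
  also have "\<dots> = fps_const (?H * V * v) - in_y P"
    unfolding R_def[symmetric] P_def J_def ww
    by (simp only: in_y_mult in_y_add in_y_diff in_y_const in_y_X in_y_1 fps_const_power
          fps_const_1_eq_1 flip: fps_const_mult fps_const_add fps_const_sub numeral_fps_const)
  finally have eq: "kernel T * N = fps_const (?H * V * v) - in_y P" .
  have "N = 0" by (rule kernel_multiple_separated[OF T eq])
  then have "?H * V * v = fps_const (P $ 0)" using eq by (intro separated_imp_const) simp
  moreover have "?H * V * (u * v) = (?H * V * v) * u" by (simp only: mult_ac)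
  ultimately have "?H * V * (u * v) = fps_const (P $ 0) * u" by simp
  then show ?thesis unfolding v by (intro exI[of _ "P $ 0"]) simp
qed

text \<open>Taking constant terms in \<open>weighted_boundary_equation\<close> and evaluating it at \<open>x = X\<close> gives two
expressions for \<open>B\<close>. There \<open>D(X) = 0\<close> and \<open>V(X) = i'(X)\<close>, and the constant terms contain the excursion
series \<open>Q $ 0 $ 0\<close>.\<close>

lemma weighted_excursion_equation:
  fixes T :: "'k::field fps"
  assumes T: "T $ 0 = 0" "T \<noteq> 0" and \<alpha>: "\<alpha> = fps_const c" "c \<noteq> 0" "c \<noteq> 1"
    and Q: "walk_equation T \<alpha> (\<alpha> * A) Q" and S: "walk_equation T 0 1 S"
    and X: "X $ 0 = 0" "\<alpha> * T * X^2 + \<alpha> * (\<alpha> - 1) * X + T^2 = 0"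
  defines "i \<equiv> boundary_invariant T S"
  shows "(Q $ 0 $ 0 - A) * (T^2 * S $ 0 $ 0 - eval_at X i) * (\<alpha> * (\<alpha> - 1) + 2 * \<alpha> * T * X)
       = \<alpha> * A * X * (2 * \<alpha> - 1 + T * X) * eval_at X (fps_deriv i)"
proof -
  obtain V where V: "i = (fps_X - fps_const X) * V + fps_const (eval_at X i)"
    using eval_at_remainder[OF X(1)] .
  then have V': "boundary_invariant T S - fps_const (eval_at X i) = (fps_X - fps_const X) * V"
    unfolding i_def[symmetric] by (simp add: algebra_simps)
  obtain B where B: "((fps_const \<alpha> * fps_const T * fps_X ^ 2 + fps_const \<alpha> * (fps_const \<alpha> - 1) * fps_X + fps_const T ^ 2)
      * (Q $ 0 - fps_const A) + fps_const \<alpha> * fps_const A * fps_X * (2 * fps_const \<alpha> - 1 + fps_const T * fps_X)) * V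
      = fps_const B * (fps_const \<alpha> * fps_const T * fps_X + fps_const (\<alpha> * (\<alpha> - 1) + \<alpha> * T * X))"
    using weighted_boundary_equation[OF T(1) \<alpha> Q S X V'] by blast
  have num: "eval_at X 2 = 2" "eval_at X 1 = 1"
    using eval_at_simps(4)[OF X(1), of 2] eval_at_simps(4)[OF X(1), of 1] by (simp_all only: numeral_fps_const[symmetric] fps_const_1_eq_1)
  have "T^2 * (Q $ 0 $ 0 - A) * V $ 0 = B * (\<alpha> * (\<alpha> - 1) + \<alpha> * T * X)"
    using arg_cong[OF B, of "\<lambda>f. f $ 0"] by (simp add: fps_const_power power2_eq_square del: fps_const_mult)
  moreover have "\<alpha> * A * X * (2 * \<alpha> - 1 + T * X) * eval_at X V = B * (\<alpha> * T * X + (\<alpha> * (\<alpha> - 1) + \<alpha> * T * X))"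
  proof -
    have "((\<alpha> * T * X^2 + \<alpha> * (\<alpha> - 1) * X + T^2) * eval_at X (Q $ 0 - fps_const A) + \<alpha> * A * X * (2 * \<alpha> - 1 + T * X)) * eval_at X V
      = B * (\<alpha> * T * X + (\<alpha> * (\<alpha> - 1) + \<alpha> * T * X))"
      using arg_cong[OF B, of "eval_at X"] by (simp only: eval_at_simps[OF X(1)] eval_at_power[OF X(1)] num)
    then show ?thesis unfolding X(2) by simp
  qed
  moreover have "T^2 * S $ 0 $ 0 - eval_at X i = - X * V $ 0"
  proof -
    have "i $ 0 = T^2 * S $ 0 $ 0" by (simp add: i_def boundary_invariant_def power2_eq_square)
    moreover have "i $ 0 = - X * V $ 0 + eval_at X i"
      using arg_cong[OF V, of "\<lambda>f. f $ 0"] by (simp add: left_diff_distrib)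
    ultimately show ?thesis by (simp add: algebra_simps)
  qed
  moreover have "eval_at X (fps_deriv i) = eval_at X V"
  proof -
    have "fps_deriv i = V + (fps_X - fps_const X) * fps_deriv V"
      by (subst V) (simp add: algebra_simps)
    then show ?thesis by (simp add: eval_at_simps[OF X(1)])
  qed
  ultimately have "T^2 * ((Q $ 0 $ 0 - A) * (T^2 * S $ 0 $ 0 - eval_at X i) * (\<alpha> * (\<alpha> - 1) + 2 * \<alpha> * T * X))
     = T^2 * (\<alpha> * A * X * (2 * \<alpha> - 1 + T * X) * eval_at X (fps_deriv i))"
    using X(2) by algebra
  then show ?thesis using T(2) by simp
qed

section \<open>Algebraic elements over a subfield\<close>

text \<open>The subfield is a set rather than a type, because the notion of algebraicity refers to a set.\<close>

locale subfield_set =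
  fixes K :: "'a::field set"
  assumes zero: "0 \<in> K" and one: "1 \<in> K"
    and add: "\<And>x y. x \<in> K \<Longrightarrow> y \<in> K \<Longrightarrow> x + y \<in> K"
    and mult: "\<And>x y. x \<in> K \<Longrightarrow> y \<in> K \<Longrightarrow> x * y \<in> K"
    and uminus: "\<And>x. x \<in> K \<Longrightarrow> - x \<in> K"
    and inverse: "\<And>x. x \<in> K \<Longrightarrow> inverse x \<in> K"
begin

lemma diff: "x \<in> K \<Longrightarrow> y \<in> K \<Longrightarrow> x - y \<in> K"
  using add[of x "- y"] uminus by simp

lemma divide: "x \<in> K \<Longrightarrow> y \<in> K \<Longrightarrow> x / y \<in> K"
  using mult inverse by (simp add: divide_inverse)

lemma sum: "(\<And>i. i \<in> I \<Longrightarrow> f i \<in> K) \<Longrightarrow> sum f I \<in> K"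
  by (induction I rule: infinite_finite_induct) (auto intro: zero add)

lemma homogeneous_system:
  assumes "finite J" "finite I" "card J < card I" "\<And>i j. i \<in> I \<Longrightarrow> j \<in> J \<Longrightarrow> A i j \<in> K"
  shows "\<exists>c. (\<forall>i\<in>I. c i \<in> K) \<and> (\<exists>i\<in>I. c i \<noteq> 0) \<and> (\<forall>j\<in>J. (\<Sum>i\<in>I. c i * A i j) = 0)"
  using assms
proof (induction J arbitrary: I A rule: finite_induct)
  case empty
  then have "I \<noteq> {}" by auto
  then show ?case by (intro exI[of _ "\<lambda>_. 1"]) (auto intro: one)
next
  case (insert j J)
  show ?case
  proof (cases "\<forall>i\<in>I. A i j = 0")
    case True
    have "card J < card I" using insert by simp
    with insert.IH[OF insert.prems(1) this, of A] insert.prems(3) True show ?thesis by auto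
  next
    case False
    then obtain p where p: "p \<in> I" "A p j \<noteq> 0" by blast
    define A' where "A' i l = A i l - A i j / A p j * A p l" for i l
    have "card J < card (I - {p})" using insert p by simp
    moreover have "A' i l \<in> K" if "i \<in> I - {p}" "l \<in> J" for i l
      using that p insert.prems(3) unfolding A'_def by (auto intro!: diff mult divide)
    ultimately obtain c where c: "\<And>i. i \<in> I - {p} \<Longrightarrow> c i \<in> K" "\<exists>i\<in>I-{p}. c i \<noteq> 0"
      "\<And>l. l \<in> J \<Longrightarrow> (\<Sum>i\<in>I-{p}. c i * A' i l) = 0"
      using insert.IH[of "I - {p}" A'] insert.prems(1) by blast
    define e where "e = - (\<Sum>i\<in>I-{p}. c i * A i j) / A p j"
    define d where "d = c(p := e)"
    have split: "(\<Sum>i\<in>I. d i * A i l) = e * A p l + (\<Sum>i\<in>I-{p}. c i * A i l)" for l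
    proof -
      have "(\<Sum>i\<in>I. d i * A i l) = d p * A p l + (\<Sum>i\<in>I-{p}. d i * A i l)"
        using insert.prems(1) p(1) by (rule sum.remove)
      also have "(\<Sum>i\<in>I-{p}. d i * A i l) = (\<Sum>i\<in>I-{p}. c i * A i l)"
        by (intro sum.cong) (auto simp: d_def)
      finally show ?thesis by (simp add: d_def)
    qed
    show ?thesis
    proof (intro exI[of _ d] conjI ballI)
      have "e \<in> K" unfolding e_def
        using c(1) insert.prems(3) p(1) by (intro divide uminus sum mult) auto
      then show "d i \<in> K" if "i \<in> I" for i using that c(1) by (auto simp: d_def)
      show "\<exists>i\<in>I. d i \<noteq> 0" using c(2) by (auto simp: d_def)
      show "(\<Sum>i\<in>I. d i * A i l) = 0" if "l \<in> insert j J" for l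
      proof (cases "l = j")
        case True then show ?thesis using p(2) by (simp add: split e_def)
      next
        case False
        have "(\<Sum>i\<in>I-{p}. c i * A' i l) = (\<Sum>i\<in>I-{p}. c i * A i l) - (\<Sum>i\<in>I-{p}. c i * A i j) / A p j * A p l"
          by (simp add: A'_def algebra_simps sum_subtractf sum_distrib_left sum_divide_distrib)
        then show ?thesis using c(3)[of l] that False by (simp add: split e_def)
      qed
    qed
  qed
qed

lemma algebraic_overI:
  assumes "\<And>i. i \<le> n \<Longrightarrow> c i \<in> K" "m \<le> n" "c m \<noteq> 0" "(\<Sum>i\<le>n. c i * x ^ i) = 0"
  shows "algebraic_over K x"
proof -
  define p where "p = (\<Sum>i\<le>n. monom (c i) i)"
  have coeff: "coeff p j = (if j \<le> n then c j else 0)" for j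
    by (auto simp: p_def coeff_sum if_distrib sum.delta cong: if_cong)
  have "poly p x = 0" using assms(4) by (simp add: p_def poly_sum poly_monom)
  moreover have "p \<noteq> 0" using coeff[of m] assms(2,3) by auto
  ultimately show ?thesis
    unfolding algebraic_over_def using coeff assms(1) zero by (intro exI[of _ p]) auto
qed

definition lin_span :: "('j \<Rightarrow> 'a) \<Rightarrow> 'j set \<Rightarrow> 'a set" where
  "lin_span v J = {\<Sum>j\<in>J. m j * v j | m. \<forall>j\<in>J. m j \<in> K}"

lemma lin_span_add: "a \<in> lin_span v J \<Longrightarrow> b \<in> lin_span v J \<Longrightarrow> a + b \<in> lin_span v J"
  unfolding lin_span_def
proof safe
  fix m m' assume "\<forall>j\<in>J. m j \<in> K" "\<forall>j\<in>J. m' j \<in> K"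
  then show "\<exists>m''. (\<Sum>j\<in>J. m j * v j) + (\<Sum>j\<in>J. m' j * v j) = (\<Sum>j\<in>J. m'' j * v j) \<and> (\<forall>j\<in>J. m'' j \<in> K)"
    by (intro exI[of _ "\<lambda>j. m j + m' j"]) (auto simp: algebra_simps sum.distrib intro: add)
qed

lemma lin_span_scale: "k \<in> K \<Longrightarrow> a \<in> lin_span v J \<Longrightarrow> k * a \<in> lin_span v J"
  unfolding lin_span_def
proof safe
  fix m assume "k \<in> K" "\<forall>j\<in>J. m j \<in> K"
  then show "\<exists>m''. k * (\<Sum>j\<in>J. m j * v j) = (\<Sum>j\<in>J. m'' j * v j) \<and> (\<forall>j\<in>J. m'' j \<in> K)"
    by (intro exI[of _ "\<lambda>j. k * m j"]) (auto simp: algebra_simps sum_distrib_left intro: mult)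
qed

lemma lin_span_0: "0 \<in> lin_span v J"
  unfolding lin_span_def using zero by (intro CollectI exI[of _ "\<lambda>_. 0"]) auto

lemma lin_span_sum: "(\<And>i. i \<in> I \<Longrightarrow> f i \<in> lin_span v J) \<Longrightarrow> sum f I \<in> lin_span v J"
  by (induction I rule: infinite_finite_induct) (auto intro: lin_span_0 lin_span_add)

lemma lin_span_base: 
  assumes "finite J" "j \<in> J"
  shows "v j \<in> lin_span v J"
  unfolding lin_span_def
  using assms zero one by (intro CollectI exI[of _ "\<lambda>i. if i = j then 1 else 0"]) (auto simp: if_distrib[of "\<lambda>x. x * _"] cong: if_cong)

lemma lin_span_stable:
  assumes "\<And>j. j \<in> J \<Longrightarrow> x * v j \<in> lin_span v J" "a \<in> lin_span v J"
  shows "x * a \<in> lin_span v J"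
proof -
  obtain m where m: "\<forall>j\<in>J. m j \<in> K" "a = (\<Sum>j\<in>J. m j * v j)" using assms(2) by (auto simp: lin_span_def)
  have "x * a = (\<Sum>j\<in>J. m j * (x * v j))" by (simp add: m sum_distrib_left mult_ac)
  also have "\<dots> \<in> lin_span v J" using m assms(1) by (auto intro!: lin_span_sum lin_span_scale[of "m _"])
  finally show ?thesis .
qed

text \<open>If multiplication by \<open>x\<close> maps the span of \<open>d\<close> elements into itself, then \<open>v, x v, \<dots>, x\<^sup>d v\<close> are
linearly dependent for each \<open>v\<close> in the span, and \<open>v \<noteq> 0\<close> can be cancelled.\<close>

lemma algebraic_if_stabilises:
  assumes J: "finite J" "j \<in> J" "v j \<noteq> 0"
    and x: "\<And>a. a \<in> lin_span v J \<Longrightarrow> x * a \<in> lin_span v J"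
  shows "algebraic_over K x"
proof -
  have "x ^ n * v j \<in> lin_span v J" for n
    by (induction n) (auto simp: lin_span_base J mult.assoc intro: x)
  then have "\<forall>n. \<exists>m. (\<forall>l\<in>J. m l \<in> K) \<and> x ^ n * v j = (\<Sum>l\<in>J. m l * v l)"
    unfolding lin_span_def by blast
  then obtain A where A: "\<And>n l. l \<in> J \<Longrightarrow> A n l \<in> K" "\<And>n. x ^ n * v j = (\<Sum>l\<in>J. A n l * v l)"
    by metis
  obtain c where c: "\<forall>i\<in>{..card J}. c i \<in> K" "\<exists>i\<in>{..card J}. c i \<noteq> 0"
     "\<forall>l\<in>J. (\<Sum>i\<le>card J. c i * A i l) = 0"
    using homogeneous_system[OF J(1), of "{..card J}" A] A(1) by auto
  have "(\<Sum>i\<le>card J. c i * x ^ i) * v j = (\<Sum>i\<le>card J. \<Sum>l\<in>J. c i * A i l * v l)"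
    by (simp add: sum_distrib_right mult.assoc A(2) sum_distrib_left)
  also have "\<dots> = (\<Sum>l\<in>J. (\<Sum>i\<le>card J. c i * A i l) * v l)"
    by (subst sum.swap) (simp add: sum_distrib_right)
  also have "\<dots> = 0" using c(3) by simp
  finally have "(\<Sum>i\<le>card J. c i * x ^ i) = 0" using J(3) by simp
  then show ?thesis using c by (auto intro: algebraic_overI)
qed

lemma algebraic_power_reduction:
  assumes "algebraic_over K x"
  obtains d m where "d > 0" "\<And>i. i < d \<Longrightarrow> m i \<in> K" "x ^ d = (\<Sum>i<d. m i * x ^ i)"
proof -
  obtain p where p: "\<And>i. coeff p i \<in> K" "p \<noteq> 0" "poly p x = 0"
    using assms unfolding algebraic_over_def by blast
  define d where "d = degree p"
  have lc: "coeff p d \<noteq> 0" using p by (simp add: d_def)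
  have sum: "(\<Sum>i<d. coeff p i * x ^ i) + coeff p d * x ^ d = 0"
    using p(3) by (simp add: poly_altdef d_def flip: lessThan_Suc_atMost)
  have "d > 0" using sum lc by (cases d) auto
  moreover have "x ^ d = (\<Sum>i<d. - (coeff p i / coeff p d) * x ^ i)"
  proof -
    have "coeff p d * x ^ d = - (\<Sum>i<d. coeff p i * x ^ i)" using sum by (simp add: eq_neg_iff_add_eq_0 add.commute)
    then have "x ^ d = - (\<Sum>i<d. coeff p i * x ^ i) / coeff p d" using lc by (simp add: field_simps)
    then show ?thesis by (simp add: sum_divide_distrib sum_negf)
  qed
  ultimately show ?thesis using that[of d "\<lambda>i. - (coeff p i / coeff p d)"] p(1) by (auto intro: uminus divide)
qed

text \<open>Multiplication by \<open>x\<close> and by \<open>y\<close> both stabilise the span of the monomials \<open>x\<^sup>i y\<^sup>j\<close> below the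
degrees of their equations, hence so do \<open>x + y\<close> and \<open>x y\<close>.\<close>

lemma algebraic_add_mult:
  assumes "algebraic_over K x" "algebraic_over K y"
  shows "algebraic_over K (x + y)" "algebraic_over K (x * y)"
proof -
  obtain d m where d: "d > 0" "\<And>i. i < d \<Longrightarrow> m i \<in> K" "x ^ d = (\<Sum>i<d. m i * x ^ i)"
    using algebraic_power_reduction[OF assms(1)] by blast
  obtain e n where e: "e > 0" "\<And>i. i < e \<Longrightarrow> n i \<in> K" "y ^ e = (\<Sum>i<e. n i * y ^ i)"
    using algebraic_power_reduction[OF assms(2)] by blast
  define J where "J = {..<d} \<times> {..<e}"
  define v where "v = (\<lambda>(i, j). x ^ i * y ^ j)"
  have J: "finite J" "(0, 0) \<in> J" "v (0, 0) \<noteq> 0" using d e by (auto simp: J_def v_def)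
  have base: "x ^ i * y ^ j \<in> lin_span v J" if "i < d" "j < e" for i j
    using lin_span_base[OF J(1), of "(i, j)" v] that by (simp add: J_def v_def)
  have "x * v l \<in> lin_span v J" if "l \<in> J" for l
  proof -
    obtain i j where l: "l = (i, j)" "i < d" "j < e" using \<open>l \<in> J\<close> by (auto simp: J_def)
    show ?thesis
    proof (cases "Suc i < d")
      case True
      then show ?thesis using base[of "Suc i" j] l by (simp add: v_def mult_ac)
    next
      case False
      then have "Suc i = d" using l by simp
      then have "x * v l = x ^ d * y ^ j" by (auto simp: v_def l mult_ac)
      also have "\<dots> = (\<Sum>i<d. m i * (x ^ i * y ^ j))" by (simp add: d(3) sum_distrib_right mult.assoc)
      also have "\<dots> \<in> lin_span v J" using base l d by (auto intro!: lin_span_sum lin_span_scale[of "m _"])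
      finally show ?thesis .
    qed
  qed
  then have sx: "x * a \<in> lin_span v J" if "a \<in> lin_span v J" for a using that by (rule lin_span_stable)
  have "y * v l \<in> lin_span v J" if "l \<in> J" for l
  proof -
    obtain i j where l: "l = (i, j)" "i < d" "j < e" using \<open>l \<in> J\<close> by (auto simp: J_def)
    show ?thesis
    proof (cases "Suc j < e")
      case True
      then show ?thesis using base[of i "Suc j"] l by (simp add: v_def mult_ac)
    next
      case False
      then have "Suc j = e" using l by simp
      then have "y * v l = y ^ e * x ^ i" by (auto simp: v_def l mult_ac)
      also have "\<dots> = (\<Sum>j<e. n j * (x ^ i * y ^ j))" by (simp add: e(3) sum_distrib_right mult.assoc mult.commute[of "y ^ _"])
      also have "\<dots> \<in> lin_span v J" using base l e by (auto intro!: lin_span_sum lin_span_scale[of "n _"])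
      finally show ?thesis .
    qed
  qed
  then have sy: "y * a \<in> lin_span v J" if "a \<in> lin_span v J" for a using that by (rule lin_span_stable)
  show "algebraic_over K (x + y)"
    using sx sy by (intro algebraic_if_stabilises[where v = v, OF J]) (auto simp: distrib_right intro: lin_span_add)
  show "algebraic_over K (x * y)"
    using sx sy by (intro algebraic_if_stabilises[where v = v, OF J]) (auto simp: mult.assoc)
qed

lemma algebraic_base: "x \<in> K \<Longrightarrow> algebraic_over K x"
  using zero one uminus by (intro algebraic_overI[of 1 "\<lambda>i. if i = 0 then - x else 1" 1]) auto

lemma algebraic_uminus: "algebraic_over K x \<Longrightarrow> algebraic_over K (- x)"
  using algebraic_add_mult(2)[OF algebraic_base[OF uminus[OF one]], of x] by simp

lemma algebraic_diff: "algebraic_over K x \<Longrightarrow> algebraic_over K y \<Longrightarrow> algebraic_over K (x - y)"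
  using algebraic_add_mult(1)[OF _ algebraic_uminus, of x y] by simp

lemma algebraic_inverse:
  assumes "algebraic_over K x"
  shows "algebraic_over K (inverse x)"
proof (cases "x = 0")
  case True then show ?thesis using algebraic_base zero by simp
next
  case False
  obtain p where p: "\<And>i. coeff p i \<in> K" "p \<noteq> 0" "poly p x = 0"
    using assms unfolding algebraic_over_def by blast
  have "poly (reflect_poly p) (inverse x) = 0"
    using False p(3) by (simp add: poly_reflect_poly_nz)
  then show ?thesis unfolding algebraic_over_def
    using p zero by (intro exI[of _ "reflect_poly p"]) (auto simp: coeff_reflect_poly)
qed

lemma algebraic_divide: "algebraic_over K x \<Longrightarrow> algebraic_over K y \<Longrightarrow> algebraic_over K (x / y)"
  using algebraic_add_mult(2)[OF _ algebraic_inverse, of x y] by (simp add: divide_inverse)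

lemma algebraic_power: "algebraic_over K x \<Longrightarrow> algebraic_over K (x ^ n)"
  by (induction n) (auto intro: algebraic_add_mult algebraic_base one)

lemma algebraic_sqrt:
  assumes "algebraic_over K (x ^ 2)"
  shows "algebraic_over K x"
proof -
  obtain d m where d: "d > 0" "\<And>i. i < d \<Longrightarrow> m i \<in> K" "(x ^ 2) ^ d = (\<Sum>i<d. m i * (x ^ 2) ^ i)"
    using algebraic_power_reduction[OF assms] by blast
  define p where "p = monom 1 (2 * d) - (\<Sum>i<d. monom (m i) (2 * i))"
  have "coeff p j \<in> K" for j
    unfolding p_def coeff_diff coeff_sum coeff_monom
    using d one zero by (intro diff sum) auto
  moreover have "poly p x = 0" using d(3) by (simp add: p_def poly_sum poly_monom power_mult)
  moreover have "coeff p (2 * d) = 1" by (simp add: p_def coeff_sum)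
  then have "p \<noteq> 0" by auto
  ultimately show ?thesis unfolding algebraic_over_def by blast
qed

end

lemma (in subfield_set) algebraic_quotient:
  assumes "algebraic_over K x" "algebraic_over K z" "x * y = z" "x \<noteq> 0"
  shows "algebraic_over K y"
proof -
  have "y = z / x" using assms by auto
  then show ?thesis using assms algebraic_divide by simp
qed

lemma (in subfield_set) subfield_set_image:
  fixes \<phi> :: "'a \<Rightarrow> 'b::field"
  assumes "\<And>x y. \<phi> (x + y) = \<phi> x + \<phi> y" "\<And>x y. \<phi> (x * y) = \<phi> x * \<phi> y" "\<phi> 1 = 1"
  shows "subfield_set (\<phi> ` K)"
proof -
  have "\<phi> 0 + \<phi> 0 = \<phi> 0 + 0" by (simp flip: assms(1))
  then have \<phi>0: "\<phi> 0 = 0" by (simp only: add_left_cancel)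
  have neg: "- \<phi> x = \<phi> (- x)" for x
    by (rule minus_unique) (simp add: \<phi>0 flip: assms(1))
  have inv: "inverse (\<phi> x) = \<phi> (inverse x)" for x
    using assms(2)[of x "inverse x"] \<phi>0 by (cases "x = 0") (simp_all add: assms(3) inverse_unique)
  show ?thesis
  proof
    show "0 \<in> \<phi> ` K" using zero \<phi>0 by (metis imageI)
    show "1 \<in> \<phi> ` K" using one assms(3) by (metis imageI)
  qed (auto simp: neg inv intro: add mult uminus inverse simp flip: assms(1,2))
qed

text \<open>Used for the embedding \<open>f(t) \<mapsto> f(s\<^sup>2)\<close>: it undoes the passage to the square root of \<open>t\<close>.\<close>

lemma (in subfield_set) algebraic_if_image_algebraic:
  fixes \<phi> :: "'a \<Rightarrow> 'b::field"
  assumes hom: "\<And>x y. \<phi> (x + y) = \<phi> x + \<phi> y" "\<And>x y. \<phi> (x * y) = \<phi> x * \<phi> y" "\<phi> 1 = 1"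
    and ker: "\<And>x. \<phi> x = 0 \<longleftrightarrow> x = 0" and alg: "algebraic_over (\<phi> ` K) (\<phi> x)"
  shows "algebraic_over K x"
proof -
  have sum: "\<phi> (\<Sum>i\<in>I. f i) = (\<Sum>i\<in>I. \<phi> (f i))" for f :: "nat \<Rightarrow> 'a" and I
    by (induction I rule: infinite_finite_induct) (auto simp: hom ker)
  have pow: "\<phi> (y ^ n) = \<phi> y ^ n" for y n by (induction n) (auto simp: hom)
  obtain p where p: "\<And>i. coeff p i \<in> \<phi> ` K" "p \<noteq> 0" "poly p (\<phi> x) = 0"
    using alg unfolding algebraic_over_def by blast
  then have "\<forall>i. \<exists>c. c \<in> K \<and> coeff p i = \<phi> c" by blast
  then obtain c where c: "\<And>i. c i \<in> K" "\<And>i. coeff p i = \<phi> (c i)" by metis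
  have "\<phi> (\<Sum>i\<le>degree p. c i * x ^ i) = 0"
    using p(3) by (simp add: sum hom pow poly_altdef c)
  moreover have "c (degree p) \<noteq> 0" using p(2) c(2)[of "degree p"] ker[of 0] by auto
  ultimately show ?thesis using c(1) ker by (intro algebraic_overI[of "degree p" c "degree p"]) auto
qed

section \<open>The auxiliary algebraic series\<close>

text \<open>The square root is taken through compositional inversion: \<open>v\<close> with \<open>2 v + v\<^sup>2 = x\<close> satisfies
\<open>(1 + v)\<^sup>2 = 1 + x\<close>. This works over every field in which \<open>2\<close> is invertible.\<close>

lemma sqrt_one_plus_exists:
  assumes "(2::'k::field) \<noteq> 0"
  obtains h :: "'k::field fps" where "h $ 0 = 1" "h^2 = 1 + 2 * fps_X^3"
proof -
  define f :: "'k fps" where "f = fps_const 2 * fps_X + fps_X^2"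
  define v where "v = fps_inv f"
  have "f oo v = fps_X" unfolding v_def
    by (rule fps_inv_right) (use assms in \<open>simp_all add: f_def\<close>)
  moreover have v0: "v $ 0 = 0" by (simp add: v_def fps_inv_def)
  ultimately have v: "2 * v + v^2 = fps_X"
    by (simp add: f_def fps_compose_add_distrib fps_compose_mult_distrib numeral_fps_const power2_eq_square)
  define h where "h = (1 + v) oo (fps_const 2 * fps_X^3)"
  have "h^2 = (1 + v)^2 oo (fps_const 2 * fps_X^3)"
    by (simp add: h_def fps_compose_power)
  also have "(1 + v)^2 = 1 + fps_X" using v by (simp add: power2_eq_square algebra_simps)
  finally have "h^2 = 1 + 2 * fps_X^3" by (simp add: fps_compose_add_distrib numeral_fps_const)
  moreover have "h $ 0 = 1" by (simp add: h_def v0)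
  ultimately show ?thesis using that by blast
qed

text \<open>With \<open>h\<^sup>2 = 1 + 2 x\<^sup>3\<close>, the equation \<open>X\<^sup>2 = s\<^sup>2 (1 + 2 X\<^sup>3)\<close> follows from \<open>e X = s h(X)\<close>, so \<open>X\<close> is
the compositional inverse of \<open>e x / h(x)\<close>. The two signs \<open>e = 1\<close> and \<open>e = -1\<close> give the two solutions.\<close>

lemma critical_point_exists:
  assumes "(2::'k::field) \<noteq> 0" "e^2 = (1::'k::field)"
  obtains X :: "'k::field fps" where "X $ 0 = 0" "X $ 1 = e" "X^2 = fps_X^2 + 2 * fps_X^2 * X^3"
proof -
  obtain h :: "'k fps" where h: "h $ 0 = 1" "h^2 = 1 + 2 * fps_X^3"
    using sqrt_one_plus_exists[OF assms(1)] .
  have e: "e \<noteq> 0" "e * e = 1" using assms(2) by (auto simp: power2_eq_square)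
  define f where "f = fps_const e * fps_X * inverse h"
  have fh: "f * h = fps_const e * fps_X" using h(1) by (simp add: f_def mult.assoc inverse_mult_eq_1)
  define X where "X = fps_inv f"
  have X0: "X $ 0 = 0" by (simp add: X_def fps_inv_def)
  have "f oo X = fps_X" unfolding X_def
    by (rule fps_inv_right) (use h e in \<open>simp_all add: f_def mult.assoc\<close>)
  then have X: "fps_const e * X = fps_X * (h oo X)"
    using arg_cong[OF fh, of "\<lambda>u. u oo X"] X0 by (simp add: fps_compose_mult_distrib)
  have "(h oo X)^2 = h^2 oo X" using X0 by (simp add: fps_compose_power)
  also have "\<dots> = 1 + 2 * X^3" unfolding h(2)
    using X0 by (simp add: fps_compose_add_distrib fps_compose_mult_distrib numeral_fps_const fps_compose_power[symmetric])
  finally have hX: "(h oo X)^2 = 1 + 2 * X^3" .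
  have "X^2 = (fps_const e * X)^2"
    using assms(2) by (simp add: power_mult_distrib fps_const_power)
  also have "\<dots> = fps_X^2 + 2 * fps_X^2 * X^3"
    unfolding X power_mult_distrib hX by (simp add: algebra_simps)
  finally have "X^2 = fps_X^2 + 2 * fps_X^2 * X^3" .
  moreover have "e * X $ 1 = 1"
    using arg_cong[OF X, of "\<lambda>u. u $ 1"] X0 h(1) by simp
  then have "X $ 1 = e" using e by (metis mult.left_commute mult.right_neutral)
  ultimately show ?thesis using that X0 by blast
qed

text \<open>With \<open>b = -1/(c (c - 1))\<close>, the substitution \<open>X = b T\<^sup>2 / (1 - y)\<close> turns the quadratic equation into
\<open>y - y\<^sup>2 = c b\<^sup>2 T\<^sup>3\<close>, which is solved by the compositional inverse of \<open>x - x\<^sup>2\<close>.\<close>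

lemma pole_exists:
  fixes T :: "'k::field fps"
  assumes T: "T $ 0 = 0" and c: "c \<noteq> 0" "c \<noteq> 1"
  obtains X r where "fps_const c * T * X^2 + fps_const c * (fps_const c - 1) * X + T^2 = 0" "X = T^2 * r" "r \<noteq> 0"
proof -
  define f :: "'k fps" where "f = fps_X - fps_X^2"
  define b where "b = - 1 / (c * (c - 1))"
  define w where "w = fps_const (c * b^2) * T^3"
  define y where "y = fps_inv f oo w"
  have w0: "w $ 0 = 0" using T by (simp add: w_def power3_eq_cube)
  have i0: "fps_inv f $ 0 = 0" by (simp add: fps_inv_def)
  have "f oo fps_inv f = fps_X" by (rule fps_inv_right) (simp_all add: f_def)
  then have "fps_inv f - fps_inv f ^ 2 = fps_X"
    using i0 by (simp add: f_def fps_compose_sub_distrib fps_compose_power[symmetric])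
  from arg_cong[OF this, of "\<lambda>u. u oo w"] have y: "y - y^2 = w"
    using w0 by (simp add: y_def fps_compose_sub_distrib fps_compose_power)
  have "(1 - y) $ 0 \<noteq> 0" using i0 by (simp add: y_def)
  then have r: "inverse (1 - y) * (1 - y) = 1" by (rule inverse_mult_eq_1)
  define s where "s = inverse (1 - y)"
  define X where "X = T^2 * (fps_const b * s)"
  have bc: "fps_const c * (fps_const c - 1) * fps_const b = -1"
  proof -
    have "fps_const c * (fps_const c - fps_const 1) * fps_const b = fps_const (c * (c - 1) * b)"
      by (simp only: fps_const_mult fps_const_sub)
    also have "c * (c - 1) * b = -1" using c by (simp add: b_def)
    finally show ?thesis by (simp only: fps_const_1_eq_1 fps_const_neg[symmetric])
  qed
  have w: "w = fps_const c * fps_const b^2 * T^3"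
    by (simp add: w_def fps_const_power)
  have eq: "fps_const c * T * X^2 + fps_const c * (fps_const c - 1) * X + T^2 = 0"
  proof -
    have *: "c * T * (T^2 * (b * s))^2 + c * (c - 1) * (T^2 * (b * s)) + T^2 = 0"
      if "y - y^2 = c * b^2 * T^3" "s * (1 - y) = 1" "c * (c - 1) * b = -1" for c b s y T :: "'k fps"
    proof -
      have "c * T * (T^2 * (b * s))^2 + c * (c - 1) * (T^2 * (b * s)) + T^2
          = T^2 * (c * b^2 * T^3 * s^2 + (c * (c - 1) * b) * s + 1)" by algebra
      also have "\<dots> = T^2 * ((y - y^2) * s^2 - s + 1)" unfolding that(1)[symmetric] that(3) by algebra
      also have "(y - y^2) * s^2 - s + 1 = 0" using that(2) by algebra
      finally show ?thesis by simp
    qed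
    show ?thesis unfolding X_def by (rule *[OF y[unfolded w] r[folded s_def] bc])
  qed
  have "b \<noteq> 0" using c by (simp add: b_def)
  moreover have "s \<noteq> 0" using r[folded s_def] by (metis mult_zero_left zero_neq_one)
  ultimately have "fps_const b * s \<noteq> 0" by simp
  with eq show ?thesis using that[OF _ X_def] by blast
qed

section \<open>Algebraicity of the excursion series\<close>

text \<open>All ingredients of \<open>weighted_excursion_equation\<close> are algebraic: the critical points and the pole as
roots of explicit polynomials, the two coefficients by \<open>unweighted_coefficients\<close>, and \<open>i\<close> and \<open>i'\<close>
at the pole by the quadratic equation and its derivative. What has to be checked is that the
linear equation for \<open>G\<close> is not degenerate.\<close>

theorem weighted_excursions_algebraic:
  fixes a :: "'k::field"
  assumes two: "(2::'k) \<noteq> 0" and a: "a \<noteq> 0" "a \<noteq> 1"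
    and "subfield_set K" and K: "fls_const a \<in> K" "fps_to_fls (fps_X^2) \<in> K"
  shows "algebraic_over K (fps_to_fls (walk_series a (fps_X^2) $ 0 $ 0))"
proof -
  interpret subfield_set K by fact
  define T :: "'k fps" where "T = fps_X^2"
  define c where "c = 1 - 1 / a"
  define \<alpha> where "\<alpha> = fps_const c"
  define b where "b = fps_const (1 / a)"
  have T: "T $ 0 = 0" "T \<noteq> 0" by (simp_all add: T_def)
  have c: "c \<noteq> 0" "c \<noteq> 1" using a by (simp_all add: c_def)
  have ab: "\<alpha> + b = 1" by (simp add: \<alpha>_def b_def c_def)
  have nz: "\<alpha> \<noteq> 0" "b \<noteq> 0" using a c by (simp_all add: \<alpha>_def b_def)
  define Q where "Q = walk_series a T"
  define S where "S = walk_series (1::'k) T"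
  define G where "G = Q $ 0 $ 0"
  define A where "A = fps_const (1 / c) * (b^2 + \<alpha> * b * G)"
  have alpha_A: "\<alpha> * A = b^2 + \<alpha> * b * G"
    using c by (simp add: A_def \<alpha>_def flip: mult.assoc)
  have Q: "walk_equation T \<alpha> (\<alpha> * A) Q"
    using walk_series_equation[OF T(1) a(1)] unfolding alpha_A
    by (simp add: Q_def G_def \<alpha>_def b_def c_def fps_const_power power_divide)
  have S: "walk_equation T 0 1 S"
    using walk_series_equation[OF T(1), of 1] by (simp add: S_def)
  obtain X where X: "X $ 0 = 0" "X $ 1 = 1" "X^2 = T + 2 * T * X^3"
    using critical_point_exists[OF two, of 1] unfolding T_def by auto
  obtain Y where Y: "Y $ 0 = 0" "Y $ 1 = -1" "Y^2 = T + 2 * T * Y^3"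
    using critical_point_exists[OF two, of "-1"] unfolding T_def by auto
  obtain Z r where Z: "\<alpha> * T * Z^2 + \<alpha> * (\<alpha> - 1) * Z + T^2 = 0" "Z = T^2 * r" "r \<noteq> 0"
    using pole_exists[OF T(1) c] unfolding \<alpha>_def by blast
  have Z0: "Z $ 0 = 0" using T by (simp add: Z(2) power2_eq_square)
  have Znz: "Z \<noteq> 0" using T Z by simp
  define g where "g = T^2 * S $ 0 $ 0"
  define d where "d = T * (T^2 * S $ 0 $ 1 - 1)"
  define I where "I = eval_at Z (boundary_invariant T S)"
  define I' where "I' = eval_at Z (fps_deriv (boundary_invariant T S))"
  define L where "L = T + Z^2 - T * Z^3"
  note F = invariant_quadratic_at[OF T(1) S Z0, folded g_def d_def I_def I'_def, folded L_def]
  note gd = unweighted_coefficients[OF T(1) S two X Y, folded g_def d_def]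
  have final: "(G - A) * (g - I) * (\<alpha> * (\<alpha> - 1) + 2 * \<alpha> * T * Z) = \<alpha> * A * Z * (2 * \<alpha> - 1 + T * Z) * I'"
    unfolding G_def g_def I_def I'_def
    by (rule weighted_excursion_equation[OF T \<alpha>_def c Q S Z0 Z(1)])

  \<comment> \<open>The derivative of the quadratic equation with respect to \<open>i\<close>, taken at the pole; its square is the discriminant.\<close>
  define E where "E = L + 2 * Z * I - g * Z"
  have Enz: "E \<noteq> 0"
  proof -
    have "E = T * (1 + T * r * Z - Z^3 + 2 * T * r * I - g * (T * r))"
      unfolding E_def L_def Z(2) by algebra
    moreover have "(1 + T * r * Z - Z^3 + 2 * T * r * I - g * (T * r)) $ 0 = 1"
      using T Z0 by (simp add: power3_eq_cube)
    then have "1 + T * r * Z - Z^3 + 2 * T * r * I - g * (T * r) \<noteq> 0" by (intro notI) simp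
    ultimately show ?thesis using T(2) by simp
  qed
  have I'nz: "I' \<noteq> 0" using F(3) by auto
  define Y' where "Y' = Z * (2 * \<alpha> - 1 + T * Z) * I'"
  have Y'nz: "Y' \<noteq> 0"
  proof -
    have "2 * \<alpha> - 1 + T * Z \<noteq> 0"
    proof
      assume *: "2 * \<alpha> - 1 + T * Z = 0"
      then have "(2 * \<alpha> - 1 + T * Z) $ 0 = 0" by simp
      then have "2 * c - 1 = 0" using T by (simp add: \<alpha>_def numeral_fps_const)
      then have "2 * \<alpha> - 1 = 0" by (simp add: \<alpha>_def numeral_fps_const)
      then show False using * T Znz by simp
    qed
    then show ?thesis using Znz I'nz by (simp add: Y'_def)
  qed
  define W where "W = (g - I) * (\<alpha> * (\<alpha> - 1) + 2 * \<alpha> * T * Z)"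
  have G_eq: "(\<alpha>^2 * (W - b * Y')) * G = b^2 * (W + \<alpha> * Y')"
  proof -
    have "(\<alpha> * G - \<alpha> * A) * W = \<alpha> * (\<alpha> * A) * Y'"
      using arg_cong[OF final, of "\<lambda>u. \<alpha> * u"] unfolding W_def Y'_def by (simp add: algebra_simps)
    then show ?thesis unfolding alpha_A using ab by algebra
  qed
  \<comment> \<open>If the coefficient of \<open>G\<close> vanished, the right-hand side would vanish as well, and the two
    conditions together give \<open>Y' = 0\<close>.\<close>
  have Gnz: "\<alpha>^2 * (W - b * Y') \<noteq> 0"
  proof
    assume "\<alpha>^2 * (W - b * Y') = 0"
    then have *: "W = b * Y'" using nz by simp
    then have "b^2 * (W + \<alpha> * Y') = 0" using G_eq by simp
    then have "W + \<alpha> * Y' = 0" using nz by simp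
    then have "Y' = 0" using * ab by algebra
    then show False using Y'nz by simp
  qed

  define alg where "alg f \<longleftrightarrow> algebraic_over K (fps_to_fls f)" for f :: "'k fps"
  have alg_add: "alg (f + h)" and alg_mult: "alg (f * h)" and alg_diff: "alg (f - h)"
    if "alg f" "alg h" for f h
    using that unfolding alg_def by (simp_all add: algebraic_add_mult algebraic_diff fls_times_fps_to_fls)
  have alg_power: "alg (f ^ n)" if "alg f" for f n
    using that unfolding alg_def by (simp add: fps_to_fls_power algebraic_power)
  have alg_uminus: "alg (- f)" if "alg f" for f
    using that unfolding alg_def by (simp add: algebraic_uminus)
  have alg_1: "alg 1" unfolding alg_def using algebraic_base[OF one] by simp
  have alg_numeral: "alg (numeral n)" for n
    by (induction n) (simp_all only: numeral_One numeral_Bit0 numeral_Bit1 alg_1 alg_add)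
  have alg_sqrt: "alg f" if "alg (f^2)" for f
    using that unfolding alg_def by (simp add: fps_to_fls_power algebraic_sqrt)
  have alg_quotient: "alg h" if "alg f" "alg e" "f * h = e" "f \<noteq> 0" for f e h
    using that algebraic_quotient[of "fps_to_fls f" "fps_to_fls e" "fps_to_fls h"]
    unfolding alg_def by (simp add: fls_times_fps_to_fls[symmetric])
  note alg_intros = alg_add alg_mult alg_diff alg_power alg_uminus alg_1 alg_numeral
  have TK: "fps_to_fls T \<in> K" using K(2) by (simp add: T_def)
  have T_alg: "alg T" unfolding alg_def by (rule algebraic_base[OF TK])
  have cK: "fls_const c \<in> K"
  proof -
    have "fls_const c = 1 - inverse (fls_const a)" by (simp add: c_def divide_inverse fls_inverse_const flip: fls_minus_const)
    then show ?thesis using K(1) by (simp add: diff one inverse)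
  qed
  have alpha_alg: "alg \<alpha>" unfolding alg_def \<alpha>_def using algebraic_base[OF cK] by simp
  have "b = 1 - \<alpha>" using ab by (simp add: eq_diff_eq add.commute)
  then have b_alg: "alg b" by (simp add: alg_diff alg_1 alpha_alg)
  have crit: "alg U" if "U^2 = T + 2 * T * U^3" for U
  proof -
    let ?t = "fps_to_fls T" and ?u = "fps_to_fls U"
    have "?u^2 = ?t + 2 * ?t * ?u^3"
      using arg_cong[OF that, of fps_to_fls] by (simp add: fls_times_fps_to_fls fps_to_fls_power)
    then have eq: "poly [:?t, 0, - 1, 2 * ?t:] ?u = 0"
      by (simp add: power2_eq_square power3_eq_cube algebra_simps)
    have "2 * ?t \<in> K" using add[OF TK TK] by (simp only: mult_2)
    then have "coeff [:?t, 0, - 1, 2 * ?t:] i \<in> K" for i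
      using TK zero uminus[OF one] by (auto simp: coeff_pCons split: nat.splits)
    moreover have "[:?t, 0, - 1, 2 * ?t:] \<noteq> 0" by simp
    ultimately show ?thesis unfolding alg_def algebraic_over_def using eq by blast
  qed
  have X_alg: "alg X" and Y_alg: "alg Y" using crit[OF X(3)] crit[OF Y(3)] .
  have Z_alg: "alg Z"
  proof -
    have "(2 * \<alpha> * T * Z + \<alpha> * (\<alpha> - 1))^2 = (\<alpha> * (\<alpha> - 1))^2 - 4 * \<alpha> * T * T^2"
      using Z(1) by algebra
    then have "alg ((2 * \<alpha> * T * Z + \<alpha> * (\<alpha> - 1))^2)"
      by (simp only:) (intro alg_intros alpha_alg T_alg)
    then have *: "alg (2 * \<alpha> * T * Z + \<alpha> * (\<alpha> - 1))" by (rule alg_sqrt)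
    have 1: "alg (2 * \<alpha> * T)" by (intro alg_intros alpha_alg T_alg)
    have 2: "alg ((2 * \<alpha> * T * Z + \<alpha> * (\<alpha> - 1)) - \<alpha> * (\<alpha> - 1))"
      by (intro alg_intros alpha_alg *)
    have 3: "2 * \<alpha> * T * Z = (2 * \<alpha> * T * Z + \<alpha> * (\<alpha> - 1)) - \<alpha> * (\<alpha> - 1)" by simp
    have 4: "2 * \<alpha> * T \<noteq> 0" using nz T two by (simp add: numeral_fps_const)
    show ?thesis by (rule alg_quotient[OF 1 2 3 4])
  qed
  have two': "(2 :: 'k fps) \<noteq> 0" using two by (simp add: numeral_fps_const)
  have g_alg: "alg g"
    by (rule alg_quotient[OF _ _ gd(1) two']) (intro alg_intros X_alg Y_alg T_alg)+
  have d_alg: "alg d"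
  proof (rule alg_quotient)
    show "- 4 * d = (2 * X - 3 * T * X^2 + g)^2" using gd(2) by simp
    show "(- 4 :: 'k fps) \<noteq> 0" using no_zero_divisors[OF two' two'] by simp
  qed (intro alg_intros X_alg T_alg g_alg)+
  have L_alg: "alg L" unfolding L_def by (intro alg_intros T_alg Z_alg)
  have E_alg: "alg E"
  proof -
    have "E^2 = (L + g * Z)^2 + 4 * d * Z^2" using F(1) unfolding E_def by algebra
    then have "alg (E^2)" by (simp only:) (intro alg_intros L_alg g_alg Z_alg d_alg)
    then show ?thesis by (rule alg_sqrt)
  qed
  have I_alg: "alg I"
  proof (rule alg_quotient)
    show "2 * Z * I = E - L + g * Z" unfolding E_def by algebra
    show "2 * Z \<noteq> 0" using Znz two' by (simp only: mult_eq_0_iff simp_thms not_False_eq_True)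
  qed (intro alg_intros Z_alg E_alg L_alg g_alg)+
  have I'_alg: "alg I'"
  proof (rule alg_quotient[of "Z * E" "(I - g) * (T + 2 * T * Z^3 - Z^2)"])
    show "Z * E * I' = (I - g) * (T + 2 * T * Z^3 - Z^2)"
      using F(1,2) unfolding E_def L_def by algebra
    show "Z * E \<noteq> 0" using Znz Enz by simp
  qed (intro alg_intros Z_alg E_alg I_alg g_alg T_alg)+
  have "alg G"
    by (rule alg_quotient[OF _ _ G_eq Gnz])
       (unfold W_def Y'_def, (intro alg_intros alpha_alg b_alg T_alg Z_alg I_alg I'_alg g_alg)+)
  then show ?thesis by (simp add: alg_def G_def Q_def T_def)
qed

lemma to_fract_sum: "to_fract (sum f I) = (\<Sum>i\<in>I. to_fract (f i))"
  by (induction I rule: infinite_finite_induct) auto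

lemma bipoly_to_fls_hom:
  "bipoly_to_fls (p + q) = bipoly_to_fls p + bipoly_to_fls q"
  "bipoly_to_fls (p * q) = bipoly_to_fls p * bipoly_to_fls q"
  "bipoly_to_fls (- p) = - bipoly_to_fls p"
  "bipoly_to_fls 1 = 1" "bipoly_to_fls 0 = 0"
proof -
  have "map_poly to_fract (p + q) = map_poly to_fract p + map_poly to_fract q"
    "map_poly to_fract (p * q) = map_poly to_fract p * map_poly to_fract q"
    "map_poly to_fract (- p) = - map_poly to_fract p"
    by (auto simp: poly_eq_iff coeff_map_poly coeff_mult to_fract_sum)
  then show "bipoly_to_fls (p + q) = bipoly_to_fls p + bipoly_to_fls q"
    "bipoly_to_fls (p * q) = bipoly_to_fls p * bipoly_to_fls q"
    "bipoly_to_fls (- p) = - bipoly_to_fls p"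
    by (simp_all add: bipoly_to_fls_def fps_of_poly_add fps_of_poly_mult fps_of_poly_uminus fls_times_fps_to_fls)
qed (simp_all add: bipoly_to_fls_def)

lemma bipoly_to_fls_eq_0_iff: "bipoly_to_fls p = 0 \<longleftrightarrow> p = 0"
proof -
  have "bipoly_to_fls p = 0 \<longleftrightarrow> map_poly to_fract p = 0"
    by (simp add: bipoly_to_fls_def fps_of_poly_eq_iff[of _ 0, simplified])
  then show ?thesis by (auto simp: poly_eq_iff coeff_map_poly)
qed

lemma subfield_set_rational_functions: "subfield_set rational_functions"
proof
  have mem: "bipoly_to_fls p / bipoly_to_fls q \<in> rational_functions" if "q \<noteq> 0" for p q
    using that by (auto simp: rational_functions_def)
  show "0 \<in> rational_functions" "1 \<in> rational_functions"
    using mem[of 1 0] mem[of 1 1] by (simp_all add: bipoly_to_fls_hom)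
  fix x assume "x \<in> rational_functions"
  then obtain p q where x: "x = bipoly_to_fls p / bipoly_to_fls q" "q \<noteq> 0" by (auto simp: rational_functions_def)
  show "- x \<in> rational_functions" using mem[of q "- p"] x by (simp add: bipoly_to_fls_hom)
  show "inverse x \<in> rational_functions"
    using mem[of p q] mem[of 1 0] x by (cases "p = 0") (simp_all add: bipoly_to_fls_hom)
  fix y assume "y \<in> rational_functions"
  then obtain r s where y: "y = bipoly_to_fls r / bipoly_to_fls s" "s \<noteq> 0" by (auto simp: rational_functions_def)
  show "x + y \<in> rational_functions"
    using mem[of "q * s" "p * s + r * q"] x y
    by (simp add: bipoly_to_fls_hom bipoly_to_fls_eq_0_iff add_frac_eq)
  show "x * y \<in> rational_functions"
    using mem[of "q * s" "p * r"] x y by (simp add: bipoly_to_fls_hom)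
qed

lemma bipoly_in_rational_functions: "bipoly_to_fls p \<in> rational_functions"
  unfolding rational_functions_def using bipoly_to_fls_hom(4)
  by (intro CollectI exI[of _ p] exI[of _ 1]) simp

lemma finite_reverse_kreweras_steps: "finite reverse_kreweras_steps"
  by (simp add: reverse_kreweras_steps_def)

theorem theorem4:
  shows "algebraic_over rational_functions
           (fps_to_fls (excursion_gf kreweras_steps indet_a indet_a))
       \<and> algebraic_over rational_functions
           (fps_to_fls (excursion_gf reverse_kreweras_steps indet_a indet_a))"
proof -
  interpret subfield_set rational_functions by (rule subfield_set_rational_functions)
  let ?\<phi> = "\<lambda>f :: rat poly fract fls. fls_compose_power f 2"
  let ?G = "excursion_gf reverse_kreweras_steps indet_a indet_a"
  have hom: "?\<phi> (f + g) = ?\<phi> f + ?\<phi> g" "?\<phi> (f * g) = ?\<phi> f * ?\<phi> g" "?\<phi> 1 = 1" for f g by simp_all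
  have ker: "?\<phi> f = 0 \<longleftrightarrow> f = 0" for f
  proof
    assume *: "?\<phi> f = 0"
    have "fls_nth f n = 0" for n
      using arg_cong[OF *, of "\<lambda>f. fls_nth f (2 * n)"] by (simp add: fls_nth_compose_power)
    then show "f = 0" by (intro fls_eqI) simp
  qed simp
  have "algebraic_over (?\<phi> ` rational_functions) (fps_to_fls (walk_series indet_a (fps_X^2) $ 0 $ 0))"
  proof (rule weighted_excursions_algebraic)
    have "(2 :: rat poly fract) = to_fract 2"
      by (simp only: one_add_one[symmetric] to_fract_add to_fract_1)
    then show "(2 :: rat poly fract) \<noteq> 0" by simp
    show "indet_a \<noteq> 0" by (simp add: indet_a_def)
    have "[:0, 1:] \<noteq> (1 :: rat poly)" by (simp add: one_pCons)
    then show "indet_a \<noteq> 1" unfolding indet_a_def to_fract_1[symmetric] to_fract_eq_iff .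
    show "subfield_set (?\<phi> ` rational_functions)" by (rule subfield_set_image[OF hom])
    have "bipoly_to_fls [:[:0, 1:]:] = fls_const indet_a"
      by (simp add: bipoly_to_fls_def map_poly_pCons indet_a_def fps_of_poly_const)
    then have "fls_const indet_a = ?\<phi> (bipoly_to_fls [:[:0, 1:]:])" by simp
    then show "fls_const indet_a \<in> ?\<phi> ` rational_functions"
      using bipoly_in_rational_functions by blast
    have X: "bipoly_to_fls [:0, 1:] = fps_to_fls fps_X"
      by (simp add: bipoly_to_fls_def map_poly_pCons)
    have "?\<phi> (bipoly_to_fls [:0, 1:]) = fps_to_fls (fps_X oo fps_X^2)"
      unfolding X by (rule fls_compose_power_fps_to_fls) simp
    then have "fps_to_fls (fps_X^2) = ?\<phi> (bipoly_to_fls [:0, 1:])" by simp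
    then show "fps_to_fls (fps_X^2) \<in> ?\<phi> ` rational_functions"
      using bipoly_in_rational_functions by blast
  qed
  also have "fps_to_fls (walk_series indet_a (fps_X^2) $ 0 $ 0) = ?\<phi> (fps_to_fls ?G)"
    by (simp add: walk_series_def endpoint_series_def fls_compose_power_fps_to_fls
        excursion_gf_eq_weight[OF finite_reverse_kreweras_steps])
  finally have *: "algebraic_over rational_functions (fps_to_fls ?G)"
    by (rule algebraic_if_image_algebraic[OF hom ker])
  have kreweras: "kreweras_steps = uminus ` reverse_kreweras_steps"
    by (auto simp: kreweras_steps_def reverse_kreweras_steps_def)
  have "excursion_gf kreweras_steps indet_a indet_a = ?G"
    unfolding kreweras by (rule excursion_gf_reverse[OF finite_reverse_kreweras_steps])
  then show ?thesis using * by simp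
qed

end
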